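(* Let $G$ be a planar graph of girth at least $8$. Then every $3$-fold correspondence-cover of $G$ has two vertex-disjoint independent transversals (i.e. two disjoint correspondence-colorings).
   Context: All graphs are finite and simple. A correspondence-cover of a graph $G$ is a pair $(L,H)$ where $H$ is a graph and $L$ maps each $v\in V(G)$ to a subset $L(v)\subseteq V(H)$ such that: the sets $L(v)$ partition $V(H)$; each $L(v)$ induces a clique in $H$; if $uv\notin E(G)$ there are no edges of $H$ between $L(u)$ and $L(v)$; if $uv\in E(G)$ the edges of $H$ between $L(u)$ and $L(v)$ form a matching. The cover is $k$-fold if $|L(v)|=k$ for all $v$. An independent transversal (correspondence-coloring) of $(L,H)$ is an independent set of $H$ containing exactly one vertex of each $L(v)$. *)

theory Defs
  imports "HOL-Analysis.Analysis"
begin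

definition simple_graph :: "'v set \<Rightarrow> 'v set set \<Rightarrow> bool" where
  "simple_graph V E \<longleftrightarrow> finite V \<and> (\<forall>e\<in>E. e \<subseteq> V \<and> card e = 2)"

definition is_cycle :: "'v set \<Rightarrow> 'v set set \<Rightarrow> 'v list \<Rightarrow> bool" where
  "is_cycle V E cs \<longleftrightarrow> length cs \<ge> 3 \<and> distinct cs \<and> set cs \<subseteq> V \<and>
     (\<forall>i < length cs. {cs ! i, cs ! ((i + 1) mod length cs)} \<in> E)"

definition girth_at_least :: "'v set \<Rightarrow> 'v set set \<Rightarrow> nat \<Rightarrow> bool" where
  "girth_at_least V E g \<longleftrightarrow> (\<forall>cs. is_cycle V E cs \<longrightarrow> length cs \<ge> g)"

definition planar :: "'v set \<Rightarrow> 'v set set \<Rightarrow> bool" where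
  "planar V E \<longleftrightarrow> (\<exists>(pos :: 'v \<Rightarrow> real^2) (\<gamma> :: 'v set \<Rightarrow> real \<Rightarrow> real^2).
     inj_on pos V \<and>
     (\<forall>e\<in>E. \<exists>u v. e = {u, v} \<and> arc (\<gamma> e) \<and> pathstart (\<gamma> e) = pos u \<and>
        pathfinish (\<gamma> e) = pos v \<and> path_image (\<gamma> e) \<inter> pos ` V = {pos u, pos v}) \<and>
     (\<forall>e\<in>E. \<forall>e'\<in>E. e \<noteq> e' \<longrightarrow> path_image (\<gamma> e) \<inter> path_image (\<gamma> e') \<subseteq> pos ` (e \<inter> e')))"

text \<open>Correspondence cover (L,H) of G=(V,E). H has vertex set the union of the L v and edge
  set EH (a set of 2-element sets).\<close>
definition correspondence_cover ::
    "'v set \<Rightarrow> 'v set set \<Rightarrow> ('v \<Rightarrow> 'c set) \<Rightarrow> 'c set set \<Rightarrow> bool" where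
  "correspondence_cover V E L EH \<longleftrightarrow>
     (\<forall>f\<in>EH. f \<subseteq> (\<Union>v\<in>V. L v) \<and> card f = 2) \<and>
     (\<forall>u\<in>V. \<forall>v\<in>V. u \<noteq> v \<longrightarrow> L u \<inter> L v = {}) \<and>
     (\<forall>v\<in>V. \<forall>x\<in>L v. \<forall>y\<in>L v. x \<noteq> y \<longrightarrow> {x, y} \<in> EH) \<and>
     (\<forall>u\<in>V. \<forall>v\<in>V. u \<noteq> v \<longrightarrow> {u, v} \<notin> E \<longrightarrow>
        (\<forall>x\<in>L u. \<forall>y\<in>L v. {x, y} \<notin> EH)) \<and>
     (\<forall>u\<in>V. \<forall>v\<in>V. {u, v} \<in> E \<longrightarrow>
        (\<forall>x\<in>L u. \<forall>y\<in>L v. \<forall>y'\<in>L v. {x, y} \<in> EH \<longrightarrow> {x, y'} \<in> EH \<longrightarrow> y = y'))"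

text \<open>k-fold: every list has exactly k elements (the partition condition of the paper
  additionally requires the L v to be nonempty, which holds here for k >= 1).\<close>
definition k_fold_cover ::
    "nat \<Rightarrow> 'v set \<Rightarrow> 'v set set \<Rightarrow> ('v \<Rightarrow> 'c set) \<Rightarrow> 'c set set \<Rightarrow> bool" where
  "k_fold_cover k V E L EH \<longleftrightarrow> correspondence_cover V E L EH \<and> (\<forall>v\<in>V. card (L v) = k)"

definition independent_transversal ::
    "'v set \<Rightarrow> ('v \<Rightarrow> 'c set) \<Rightarrow> 'c set set \<Rightarrow> 'c set \<Rightarrow> bool" where
  "independent_transversal V L EH I \<longleftrightarrow>
     I \<subseteq> (\<Union>v\<in>V. L v) \<and>
     (\<forall>x\<in>I. \<forall>y\<in>I. {x, y} \<notin> EH) \<and>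
     (\<forall>v\<in>V. card (I \<inter> L v) = 1)"

end

theory Submission
  imports Defs
begin

text \<open>
  Two disjoint colourings assign to each vertex one of the 6 ordered pairs of distinct colours of
  its list. A coloured neighbour forbids at most 3 of these pairs, while an uncoloured neighbour of
  degree 2 whose other neighbour is coloured forbids at most one. Hence a vertex \<open>w\<close> with \<open>a\<close>
  neighbours of degree 2 and \<open>b\<close> other neighbours is reducible whenever \<open>a + 3 b \<le> 5\<close>: colour
  everything except \<open>w\<close> and its neighbours of degree 2, then \<open>w\<close>, then these neighbours. A
  discharging argument shows that a graph without reducible vertex has average degree at least 8/3,
  which is impossible for planar graphs of girth 8.

  The bound on the average degree comes from counting faces. Each edge outside a maximal forest
  splits a face, by the Jordan curve theorem; the edges touching a face contain a cycle, because
  forests do not separate the plane; and an edge on a cycle touches at most two faces, by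
  Janiszewski's theorem.
\<close>

section \<open>Cycles and forests\<close>

definition acyclic_graph :: "'v set \<Rightarrow> 'v set set \<Rightarrow> bool" where
  "acyclic_graph V E \<longleftrightarrow> (\<nexists>cs. is_cycle V E cs)"

definition cycle_edges :: "'v list \<Rightarrow> 'v set set" where
  "cycle_edges cs = (\<lambda>i. {cs ! i, cs ! ((i + 1) mod length cs)}) ` {..<length cs}"

lemma simple_graph_subset: "simple_graph V E \<Longrightarrow> F \<subseteq> E \<Longrightarrow> simple_graph V F"
  unfolding simple_graph_def by blast

lemma simple_graph_finite_edges:
  assumes "simple_graph V E"
  shows "finite E"
proof -
  have "E \<subseteq> Pow V" "finite (Pow V)"
    using assms by (auto simp: simple_graph_def)
  then show ?thesis by (rule finite_subset)
qed

lemma simple_graph_edge_other: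
  assumes "simple_graph V E" "e \<in> E" "v \<in> e"
  obtains u where "e = {v, u}" "u \<noteq> v" "u \<in> V"
proof -
  have "card e = 2" "e \<subseteq> V" using assms by (auto simp: simple_graph_def)
  then obtain a b where "e = {a, b}" "a \<noteq> b" by (auto simp: card_2_iff)
  with \<open>e \<subseteq> V\<close> \<open>v \<in> e\<close> that show ?thesis by (auto simp: insert_commute)
qed

lemma is_cycle_iff_cycle_edges:
  "is_cycle V E cs \<longleftrightarrow> length cs \<ge> 3 \<and> distinct cs \<and> set cs \<subseteq> V \<and> cycle_edges cs \<subseteq> E"
  by (auto simp: is_cycle_def cycle_edges_def)

lemma acyclic_graph_mono:
  "acyclic_graph V E \<Longrightarrow> W \<subseteq> V \<Longrightarrow> F \<subseteq> E \<Longrightarrow> acyclic_graph W F"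
  unfolding acyclic_graph_def is_cycle_iff_cycle_edges by blast

text \<open>Two positions give the same edge only if each is the cyclic successor of the other,
  which length at least 3 excludes. This turns the girth into a lower bound on the number of edges
  of a cycle.\<close>

lemma card_cycle_edges:
  assumes "length cs \<ge> 3" "distinct cs"
  shows "card (cycle_edges cs) = length cs"
proof -
  let ?n = "length cs"
  have "inj_on (\<lambda>i. {cs ! i, cs ! ((i + 1) mod ?n)}) {..<?n}"
  proof (rule inj_onI)
    fix i j
    assume ij: "i \<in> {..<?n}" "j \<in> {..<?n}"
      and eq: "{cs ! i, cs ! ((i + 1) mod ?n)} = {cs ! j, cs ! ((j + 1) mod ?n)}"
    have lt: "(i + 1) mod ?n < ?n" "(j + 1) mod ?n < ?n"
      using assms(1) by (intro mod_less_divisor; linarith)+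
    have "i = j \<or> i = (j + 1) mod ?n \<and> (i + 1) mod ?n = j"
      using eq ij lt assms(2) by (auto simp: doubleton_eq_iff nth_eq_iff_index_eq)
    moreover have False if "i = (j + 1) mod ?n" "(i + 1) mod ?n = j"
    proof (cases "j + 1 < ?n")
      case True
      then have "i = j + 1" using that(1) by simp
      with True that(2) assms(1) show False by (cases "j + 2 < ?n") (auto simp: mod_if split: if_splits)
    next
      case False
      with ij have "j + 1 = ?n" by auto
      with that assms(1) show False by auto
    qed
    ultimately show "i = j" by blast
  qed
  then show ?thesis by (simp add: cycle_edges_def card_image)
qed

text \<open>Rotating the cycle to start just behind \<open>e\<close> makes \<open>e\<close> the
  closing pair, so the remaining edges are exactly the consecutive pairs of the list.\<close>

lemma cycle_edge_complement_path:
  assumes cyc: "is_cycle V E cs" and e: "e \<in> cycle_edges cs"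
  obtains xs where "distinct xs" "length xs \<ge> 3" "e = {hd xs, last xs}"
    "successively (\<lambda>a b. {a, b} \<in> E - {e}) xs"
proof -
  let ?n = "length cs"
  have n: "?n \<ge> 3" and dist: "distinct cs"
    and edge: "\<And>i. i < ?n \<Longrightarrow> {cs ! i, cs ! ((i + 1) mod ?n)} \<in> E"
    using cyc by (auto simp: is_cycle_def)
  obtain k where k: "k < ?n" "e = {cs ! k, cs ! ((k + 1) mod ?n)}"
    using e by (auto simp: cycle_edges_def)
  have "cs \<noteq> []" using n by auto
  define xs where "xs = rotate (k + 1) cs"
  have len: "length xs = ?n" by (simp add: xs_def)
  have nth: "xs ! i = cs ! ((k + 1 + i) mod ?n)" if "i < ?n" for i
    using that nth_rotate[of i cs "k + 1"] by (simp add: xs_def add.commute)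
  have dxs: "distinct xs" using dist by (simp add: xs_def)
  have hd: "hd xs = cs ! ((k + 1) mod ?n)"
    using nth[of 0] \<open>cs \<noteq> []\<close> by (simp add: xs_def hd_conv_nth)
  have "k + 1 + (?n - 1) = k + ?n" using n by simp
  then have "(k + 1 + (?n - 1)) mod ?n = k" using k by simp
  then have last: "last xs = cs ! k"
    using nth[of "?n - 1"] n len by (subst last_conv_nth) auto
  have e_eq: "e = {hd xs, last xs}" using k hd last by auto
  have "{xs ! i, xs ! Suc i} \<in> E - {e}" if "Suc i < ?n" for i
  proof -
    have "((k + 1 + i) mod ?n + 1) mod ?n = (k + 1 + Suc i) mod ?n"
      by (simp add: mod_Suc_eq)
    moreover have "(k + 1 + i) mod ?n < ?n" using n by (intro mod_less_divisor) linarith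
    ultimately have inE: "{xs ! i, xs ! Suc i} \<in> E"
      using edge[of "(k + 1 + i) mod ?n"] nth[of i] nth[of "Suc i"] that by auto
    have "e = {xs ! 0, xs ! (?n - 1)}"
      using e_eq n len by (metis hd_conv_nth last_conv_nth list.size(3) not_numeral_le_zero)
    \<comment> \<open>With at least three distinct entries, no consecutive pair consists of the
      first and the last entry.\<close>
    moreover have "xs ! Suc i \<noteq> xs ! 0" "xs ! i \<noteq> xs ! 0 \<or> xs ! Suc i \<noteq> xs ! (?n - 1)"
      using that n len nth_eq_iff_index_eq[OF dxs, of "Suc i" 0]
        nth_eq_iff_index_eq[OF dxs, of i 0] nth_eq_iff_index_eq[OF dxs, of "Suc i" "?n - 1"]
      by linarith+
    ultimately have "{xs ! i, xs ! Suc i} \<noteq> e" by (auto simp only: doubleton_eq_iff)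
    with inE show ?thesis by blast
  qed
  then have "successively (\<lambda>a b. {a, b} \<in> E - {e}) xs"
    by (auto simp: successively_conv_nth len)
  with that dxs n len e_eq show ?thesis by metis
qed

text \<open>An end of a longest path is a leaf.\<close>
lemma acyclic_graph_leaf:
  assumes sg: "simple_graph V E" and "E \<noteq> {}" and acyc: "acyclic_graph V E"
  obtains v e where "e \<in> E" "v \<in> e" "\<And>e'. e' \<in> E \<Longrightarrow> v \<in> e' \<Longrightarrow> e' = e"
proof -
  let ?P = "\<lambda>xs. distinct xs \<and> set xs \<subseteq> V \<and> length xs \<ge> 2 \<and> successively (\<lambda>a b. {a, b} \<in> E) xs"
  have finV: "finite V" using sg by (simp add: simple_graph_def)
  obtain e0 where "e0 \<in> E" using \<open>E \<noteq> {}\<close> by blast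
  then obtain a b where "e0 = {a, b}" "a \<noteq> b" "a \<in> V" "b \<in> V"
    using sg unfolding simple_graph_def by (metis card_2_iff insert_subset)
  then have "?P [a, b]" using \<open>e0 \<in> E\<close> by simp
  moreover have "\<forall>xs. ?P xs \<longrightarrow> length xs < card V + 1"
    using finV by (metis card_mono distinct_card less_Suc_eq_le Suc_eq_plus1)
  ultimately obtain xs where xs: "?P xs" and max: "\<And>ys. ?P ys \<Longrightarrow> length ys \<le> length xs"
    using ex_has_greatest_nat[of ?P "[a, b]" length "card V + 1"] by auto
  obtain v u zs where xs_eq: "xs = v # u # zs"
    using xs by (cases xs; cases "tl xs") auto
  show ?thesis
  proof (rule that)
    show "{v, u} \<in> E" "v \<in> {v, u}" using xs xs_eq by auto
    fix e' assume e': "e' \<in> E" "v \<in> e'"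
    then obtain y where y: "e' = {v, y}" "y \<noteq> v" "y \<in> V"
      using simple_graph_edge_other[OF sg] by metis
    show "e' = {v, u}"
    proof (rule ccontr)
      assume "e' \<noteq> {v, u}"
      with y have "y \<noteq> u" by auto
      \<comment> \<open>A neighbour of the end \<open>v\<close> off the path would prolong it,
        against maximality.\<close>
      have "y \<in> set xs"
      proof (rule ccontr)
        assume "y \<notin> set xs"
        then have "?P (y # xs)" using xs y e' xs_eq by (auto simp: insert_commute)
        then show False using max[of "y # xs"] by simp
      qed
      then obtain k where k: "k < length xs" "xs ! k = y" by (auto simp: in_set_conv_nth)
      have k2: "k \<ge> 2"
      proof (rule ccontr)
        assume "\<not> k \<ge> 2"
        then have "k = 0 \<or> k = 1" by auto
        with k y \<open>y \<noteq> u\<close> show False by (auto simp: xs_eq)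
      qed
      \<comment> \<open>The initial segment from \<open>v\<close> up to \<open>y\<close> is closed
        by the edge \<open>e'\<close>; \<open>k \<ge> 2\<close> gives it at least three
        vertices.\<close>
      let ?cs = "take (k + 1) xs"
      have len: "length ?cs = k + 1" using k by simp
      have "{?cs ! i, ?cs ! ((i + 1) mod (k + 1))} \<in> E" if "i < k + 1" for i
      proof (cases "i = k")
        case True
        then have "?cs ! i = y" using k by simp
          moreover have "?cs ! ((i + 1) mod (k + 1)) = v" using True by (simp add: xs_eq)
          ultimately show ?thesis using e' y by (simp add: insert_commute)
      next
        case False
        with that have "i < k" by simp
        then show ?thesis
          using k xs by (simp add: successively_conv_nth)
      qed
      then have "is_cycle V E ?cs"
        unfolding is_cycle_def len using k2 xs by (auto dest: in_set_takeD)
      then show False using acyc by (auto simp: acyclic_graph_def)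
    qed
  qed
qed

text \<open>Induction on the number of edges: deleting a leaf together with its only edge lowers
  both counts by one.\<close>

lemma acyclic_graph_card_edges:
  assumes "simple_graph V E" "acyclic_graph V E" "V \<noteq> {}"
  shows "card E + 1 \<le> card V"
  using assms
proof (induction "card E" arbitrary: V E)
  case 0
  then have "card V > 0" by (auto simp: simple_graph_def card_gt_0_iff)
  with 0 show ?case by simp
next
  case (Suc n)
  have finV: "finite V" using Suc.prems by (simp add: simple_graph_def)
  have "E \<noteq> {}" using Suc.hyps(2) by auto
  then obtain v e where ve: "e \<in> E" "v \<in> e" "\<And>e'. e' \<in> E \<Longrightarrow> v \<in> e' \<Longrightarrow> e' = e"
    using acyclic_graph_leaf Suc.prems by metis
  obtain u where u: "e = {v, u}" "u \<noteq> v" "u \<in> V"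
    using simple_graph_edge_other[OF Suc.prems(1) ve(1,2)] .
  have "v \<in> V" using ve Suc.prems by (auto simp: simple_graph_def)
  have finE: "finite E" using Suc.hyps(2) by (metis card.infinite nat.distinct(1))
  have "n = card (E - {e})" using Suc.hyps(2) ve(1) by simp
  moreover have "simple_graph (V - {v}) (E - {e})"
    unfolding simple_graph_def
  proof (intro conjI ballI)
    fix e' assume "e' \<in> E - {e}"
    moreover from this have "v \<notin> e'" using ve(3) by blast
    ultimately show "e' \<subseteq> V - {v}" "card e' = 2"
      using Suc.prems(1) by (auto simp: simple_graph_def)
  qed (use finV in simp)
  moreover have "acyclic_graph (V - {v}) (E - {e})"
    using acyclic_graph_mono Suc.prems(2) by (metis Diff_subset)
  moreover have "V - {v} \<noteq> {}" using u by blast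
  ultimately have "card (E - {e}) + 1 \<le> card (V - {v})"
    by (rule Suc.hyps(1))
  moreover have "card (E - {e}) + 1 = card E"
    using card_Suc_Diff1[OF finE ve(1)] by simp
  moreover have "card (V - {v}) + 1 = card V"
    using card_Suc_Diff1[OF finV \<open>v \<in> V\<close>] by simp
  ultimately show ?case by linarith
qed

text \<open>By maximality any further edge \<open>e\<close> creates a cycle, and this cycle uses
  \<open>e\<close> because \<open>F\<close> alone has none. \<open>F\<close> serves as the spanning
  forest in the count of faces.\<close>

lemma maximal_acyclic_subgraph:
  assumes "finite E"
  obtains F where "F \<subseteq> E" "acyclic_graph V F"
    "\<And>e. e \<in> E - F \<Longrightarrow> \<exists>cs. is_cycle V (insert e F) cs \<and> e \<in> cycle_edges cs"
proof -
  let ?A = "{F. F \<subseteq> E \<and> acyclic_graph V F}"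
  have "\<not> is_cycle V {} cs" for cs
    by (cases cs) (auto simp: is_cycle_def)
  then have "{} \<in> ?A" by (simp add: acyclic_graph_def)
  moreover have "finite ?A" using assms by simp
  ultimately obtain F where F: "F \<in> ?A" and "\<forall>F' \<in> ?A. F \<subseteq> F' \<longrightarrow> F = F'"
    using finite_has_maximal[of ?A] by auto
  then have max: "F' = F" if "F' \<in> ?A" "F \<subseteq> F'" for F'
    using that by blast
  have "\<exists>cs. is_cycle V (insert e F) cs \<and> e \<in> cycle_edges cs" if "e \<in> E - F" for e
  proof -
    have "\<not> acyclic_graph V (insert e F)" using max[of "insert e F"] F that by auto
    then obtain cs where "is_cycle V (insert e F) cs" by (auto simp: acyclic_graph_def)
    moreover have "\<not> is_cycle V F cs" using F by (auto simp: acyclic_graph_def)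
    ultimately show ?thesis by (auto simp: is_cycle_iff_cycle_edges)
  qed
  with that F show ?thesis by blast
qed

section \<open>Faces of plane graphs\<close>

text \<open>The drawing lives in \<open>complex\<close>, the type for which the Jordan curve theorem
  and Janiszewski's theorem are stated.\<close>

locale plane_graph =
  fixes V :: "'v set" and E :: "'v set set"
    and pos :: "'v \<Rightarrow> complex" and \<gamma> :: "'v set \<Rightarrow> real \<Rightarrow> complex"
  assumes simple: "simple_graph V E"
    and edge_arc: "e \<in> E \<Longrightarrow> \<exists>u v. e = {u, v} \<and> arc (\<gamma> e) \<and> pathstart (\<gamma> e) = pos u \<and> pathfinish (\<gamma> e) = pos v"
    and edges_disjoint: "e \<in> E \<Longrightarrow> e' \<in> E \<Longrightarrow> e \<noteq> e' \<Longrightarrow>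
      path_image (\<gamma> e) \<inter> path_image (\<gamma> e') \<subseteq> pos ` (e \<inter> e')"
begin

definition draw :: "'v set set \<Rightarrow> complex set" where
  "draw F = (\<Union>e\<in>F. path_image (\<gamma> e))"

definition inner_edge :: "'v set \<Rightarrow> complex set" where
  "inner_edge e = path_image (\<gamma> e) - pos ` e"

text \<open>Faces are represented by sample points, at most one in each component of the complement
  of the drawing. A lower bound on the number of faces is then the cardinality of a finite set of
  points.\<close>

definition in_distinct_faces :: "'v set set \<Rightarrow> complex set \<Rightarrow> bool" where
  "in_distinct_faces F R \<longleftrightarrow> R \<subseteq> - draw F \<and>
    (\<forall>r\<in>R. \<forall>r'\<in>R. connected_component (- draw F) r r' \<longrightarrow> r = r')"

text \<open>Incidence of an edge with the face of \<open>r\<close>. Only inner points of the edge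
  count, so that sharing a mere vertex with the boundary of the face is not enough.\<close>

definition touches :: "'v set set \<Rightarrow> complex \<Rightarrow> 'v set \<Rightarrow> bool" where
  "touches F r e \<longleftrightarrow> inner_edge e \<inter> closure (connected_component_set (- draw F) r) \<noteq> {}"

lemma finite_edges: "finite E"
  using simple_graph_finite_edges[OF simple] .

lemma arc_edge: "e \<in> E \<Longrightarrow> arc (\<gamma> e)"
  using edge_arc by blast

lemma pos_edge: "e \<in> E \<Longrightarrow> pos ` e = {pathstart (\<gamma> e), pathfinish (\<gamma> e)}"
  using edge_arc[of e] by auto

lemma inner_edge_eq: "e \<in> E \<Longrightarrow> inner_edge e = \<gamma> e ` {0<..<1}"
  unfolding inner_edge_def using pos_edge simple_path_endless arc_imp_simple_path arc_edge by metis

lemma connected_inner_edge: "e \<in> E \<Longrightarrow> connected (inner_edge e)"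
  unfolding inner_edge_def
  using pos_edge connected_simple_path_endless arc_imp_simple_path arc_edge by metis

lemma inner_edge_nonempty: "e \<in> E \<Longrightarrow> inner_edge e \<noteq> {}"
  by (simp add: inner_edge_eq)

lemma draw_mono: "F \<subseteq> F' \<Longrightarrow> draw F \<subseteq> draw F'"
  unfolding draw_def by blast

lemma draw_insert: "draw (insert e F) = path_image (\<gamma> e) \<union> draw F"
  by (simp add: draw_def)

lemma edge_subset_draw: "e \<in> F \<Longrightarrow> path_image (\<gamma> e) \<subseteq> draw F"
  unfolding draw_def by blast

lemma compact_draw: "F \<subseteq> E \<Longrightarrow> compact (draw F)"
  unfolding draw_def using finite_edges arc_edge
  by (meson arc_imp_path compact_UN compact_path_image finite_subset subsetD)

lemma open_Compl_draw: "F \<subseteq> E \<Longrightarrow> open (- draw F)"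
  using compact_draw by (simp add: compact_imp_closed open_Compl)

lemma edge_Int_draw: "F \<subseteq> E \<Longrightarrow> e \<in> E \<Longrightarrow> e \<notin> F \<Longrightarrow> path_image (\<gamma> e) \<inter> draw F \<subseteq> pos ` e"
  unfolding draw_def using edges_disjoint[of e] by blast

lemma inner_edge_Int_draw: "F \<subseteq> E \<Longrightarrow> e \<in> E \<Longrightarrow> e \<notin> F \<Longrightarrow> inner_edge e \<subseteq> - draw F"
  using edge_Int_draw[of F e] unfolding inner_edge_def by blast

lemma connected_component_draw_mono:
  "connected_component (- draw F') a b \<Longrightarrow> F \<subseteq> F' \<Longrightarrow> connected_component (- draw F) a b"
  by (meson Compl_anti_mono connected_component_of_subset draw_mono)

section \<open>Paths and cycles of the graph as arcs in the plane\<close>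

lemma oriented_edge:
  assumes "{x, y} \<in> E"
  obtains g where "arc g" "pathstart g = pos x" "pathfinish g = pos y"
    "path_image g = path_image (\<gamma> {x, y})"
proof -
  obtain u v where uv: "{x, y} = {u, v}" "arc (\<gamma> {x, y})"
    "pathstart (\<gamma> {x, y}) = pos u" "pathfinish (\<gamma> {x, y}) = pos v"
    using edge_arc[OF assms] by blast
  from uv(1) consider "x = u" "y = v" | "x = v" "y = u" by (auto simp: doubleton_eq_iff)
  then show ?thesis
  proof cases
    case 1
    with uv that show ?thesis by blast
  next
    case 2
    with uv that[of "reversepath (\<gamma> {x, y})"] show ?thesis by (simp add: arc_reversepath)
  qed
qed

text \<open>The edge arcs are joined one after the other. Recording that the arc uses only edges
  inside \<open>set xs\<close> keeps the induction going: the first vertex is on none of the later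
  edges, so the first edge meets the rest only in the second vertex.\<close>

lemma path_arc:
  assumes "F \<subseteq> E" "successively (\<lambda>a b. {a, b} \<in> F) xs" "distinct xs" "length xs \<ge> 2"
  shows "\<exists>q. arc q \<and> pathstart q = pos (hd xs) \<and> pathfinish q = pos (last xs) \<and>
    path_image q \<subseteq> draw {e \<in> F. e \<subseteq> set xs}"
  using assms(2-)
proof (induction xs)
  case Nil
  then show ?case by simp
next
  case (Cons x ys)
  then obtain y zs where ys: "ys = y # zs" by (cases ys) auto
  have xy: "{x, y} \<in> F" using Cons.prems ys by simp
  then obtain g where g: "arc g" "pathstart g = pos x" "pathfinish g = pos y"
    "path_image g = path_image (\<gamma> {x, y})"
    using oriented_edge assms(1) by (metis subsetD)
  show ?case
  proof (cases zs)
    case Nil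
    have "path_image g \<subseteq> draw {e \<in> F. e \<subseteq> set (x # ys)}"
      using g(4) xy ys by (auto simp: draw_def)
    with g show ?thesis unfolding ys Nil by auto
  next
    case (Cons z zs')
    then obtain q where q: "arc q" "pathstart q = pos y" "pathfinish q = pos (last ys)"
      "path_image q \<subseteq> draw {e \<in> F. e \<subseteq> set ys}"
      using Cons.IH Cons.prems ys by auto
    have x: "x \<notin> set ys" using Cons.prems by simp
    have "path_image (\<gamma> {x, y}) \<inter> path_image (\<gamma> e) \<subseteq> {pos y}" if "e \<in> F" "e \<subseteq> set ys" for e
    proof -
      have "e \<noteq> {x, y}" "{x, y} \<inter> e \<subseteq> {y}" using that x by auto
      then show ?thesis using edges_disjoint[of "{x, y}" e] xy that assms(1) by blast
    qed
    then have "path_image (\<gamma> {x, y}) \<inter> draw {e \<in> F. e \<subseteq> set ys} \<subseteq> {pos y}"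
      unfolding draw_def by auto
    then have "path_image g \<inter> path_image q \<subseteq> {pathstart q}"
      using q(4) unfolding g(4) q(2) by (metis Int_mono order_refl subset_trans)
    then have "arc (g +++ q)" using g q by (intro arc_join) auto
    moreover have "path_image (g +++ q) \<subseteq> draw {e \<in> F. e \<subseteq> set (x # ys)}"
    proof -
      have "path_image g \<subseteq> draw {e \<in> F. e \<subseteq> set (x # ys)}"
        using g(4) xy ys by (auto simp: draw_def)
      moreover have "draw {e \<in> F. e \<subseteq> set ys} \<subseteq> draw {e \<in> F. e \<subseteq> set (x # ys)}"
        by (rule draw_mono) auto
      ultimately show ?thesis using q g by (simp add: path_image_join)
    qed
    ultimately show ?thesis using q g ys by (intro exI[of _ "g +++ q"]) simp
  qed
qed

text \<open>\<open>q\<close> is the rest of the cycle, oriented so that following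
  \<open>\<gamma> e\<close> by \<open>q\<close> gives a closed curve.\<close>

lemma cycle_arc:
  assumes "F \<subseteq> E" "is_cycle V F cs" "e \<in> cycle_edges cs"
  obtains q where "arc q" "pathstart q = pathfinish (\<gamma> e)" "pathfinish q = pathstart (\<gamma> e)"
    "path_image q \<subseteq> draw (F - {e})"
proof -
  have eE: "e \<in> E" using assms by (auto simp: is_cycle_iff_cycle_edges)
  obtain xs where xs: "distinct xs" "length xs \<ge> 3" "e = {hd xs, last xs}"
    "successively (\<lambda>a b. {a, b} \<in> F - {e}) xs"
    using cycle_edge_complement_path[OF assms(2,3)] .
  have "F - {e} \<subseteq> E" using assms(1) by blast
  from path_arc[OF this xs(4,1)] xs(2)
  obtain q where q: "arc q" "pathstart q = pos (hd xs)" "pathfinish q = pos (last xs)"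
    "path_image q \<subseteq> draw {e' \<in> F - {e}. e' \<subseteq> set xs}"
    by auto
  have "draw {e' \<in> F - {e}. e' \<subseteq> set xs} \<subseteq> draw (F - {e})" by (rule draw_mono) auto
  with q(4) have sub: "path_image q \<subseteq> draw (F - {e})" by blast
  have "{pathstart (\<gamma> e), pathfinish (\<gamma> e)} = {pos (hd xs), pos (last xs)}"
    using pos_edge[OF eE] xs(3) by (metis image_empty image_insert)
  then consider "pathstart (\<gamma> e) = pos (hd xs)" "pathfinish (\<gamma> e) = pos (last xs)"
    | "pathstart (\<gamma> e) = pos (last xs)" "pathfinish (\<gamma> e) = pos (hd xs)"
    by (auto simp: doubleton_eq_iff)
  then show ?thesis
  proof cases
    case 1
    with that[of "reversepath q"] q sub show ?thesis by (simp add: arc_reversepath)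
  next
    case 2
    with that[of q] q sub show ?thesis by simp
  qed
qed

section \<open>Separation of the plane by forests and by cycles\<close>

text \<open>Induction by deleting a leaf edge. Its arc meets the remaining drawing in at most one
  point, neither of the two sets separates the plane, and by Janiszewski's theorem neither does
  their union.\<close>

lemma connected_Compl_forest:
  assumes "F \<subseteq> E" "acyclic_graph V F"
  shows "connected (- draw F)"
  using assms
proof (induction "card F" arbitrary: F)
  case 0
  then have "F = {}" using finite_edges finite_subset by fastforce
  then show ?case by (simp add: draw_def connected_UNIV)
next
  case (Suc n)
  have "simple_graph V F" using simple Suc.prems(1) by (rule simple_graph_subset)
  moreover have "F \<noteq> {}" using Suc.hyps(2) by auto
  ultimately obtain v e where e: "e \<in> F" "v \<in> e" and leaf: "\<And>e'. e' \<in> F \<Longrightarrow> v \<in> e' \<Longrightarrow> e' = e"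
    using acyclic_graph_leaf[of V F] Suc.prems(2) by metis
  have eE: "e \<in> E" using e Suc.prems by blast
  obtain u where u: "e = {v, u}" using simple_graph_edge_other[OF simple eE e(2)] .
  let ?F = "F - {e}"
  have F': "?F \<subseteq> E" using Suc.prems by blast
  have "connected (- draw ?F)"
  proof (rule Suc.hyps(1))
    show "n = card ?F" using Suc.hyps(2) e by simp
    show "acyclic_graph V ?F" using acyclic_graph_mono[OF Suc.prems(2)] by blast
  qed (rule F')
  moreover have "connected (- path_image (\<gamma> e))"
    using connected_arc_complement[OF arc_edge[OF eE]] by simp
  moreover have "connected (path_image (\<gamma> e) \<inter> draw ?F)"
  proof -
    have "path_image (\<gamma> e) \<inter> path_image (\<gamma> e') \<subseteq> {pos u}" if "e' \<in> ?F" for e'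
    proof -
      have "e \<inter> e' \<subseteq> {u}" using that leaf u by blast
      then show ?thesis using edges_disjoint[of e e'] that eE F' by blast
    qed
    then have "path_image (\<gamma> e) \<inter> draw ?F \<subseteq> {pos u}" unfolding draw_def by blast
    then show ?thesis by (metis connected_empty connected_sing subset_singletonD)
  qed
  moreover have "draw F = path_image (\<gamma> e) \<union> draw ?F"
    using e draw_insert[of e ?F] by (simp add: insert_absorb)
  moreover have "compact (path_image (\<gamma> e))" "closed (draw ?F)"
    using arc_edge[OF eE] compact_draw[OF F'] by (auto simp: compact_arc_image compact_imp_closed)
  ultimately show ?case
    using Janiszewski[of "path_image (\<gamma> e)" "draw ?F"]
    by (simp add: connected_iff_connected_component del: Compl_Un)
qed

text \<open>The cycle through \<open>e\<close> meets the rest of the drawing in the connected set \<open>q\<close>, so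
  by Janiszewski's theorem it is the only obstacle to joining \<open>a\<close> and \<open>b\<close>.\<close>
lemma same_face:
  assumes F: "F \<subseteq> E" "e \<in> F"
    and q: "arc q" "pathstart q = pathfinish (\<gamma> e)" "pathfinish q = pathstart (\<gamma> e)"
      "path_image q \<subseteq> draw (F - {e})"
    and "connected_component (- (path_image (\<gamma> e) \<union> path_image q)) a b"
    and "connected_component (- draw (F - {e})) a b"
  shows "connected_component (- draw F) a b"
proof -
  let ?J = "path_image (\<gamma> e) \<union> path_image q"
  have eE: "e \<in> E" and F': "F - {e} \<subseteq> E" using F by auto
  have "pos ` e \<subseteq> path_image q"
    using q(2,3) pos_edge[OF eE] by (metis insert_subset empty_subsetI pathfinish_in_path_image pathstart_in_path_image)
  moreover have "path_image (\<gamma> e) \<inter> draw (F - {e}) \<subseteq> pos ` e"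
    using edge_Int_draw[OF F' eE] by blast
  \<comment> \<open>The arc of \<open>e\<close> meets the rest of the drawing only in its ends, and
    these lie on \<open>q\<close>.\<close>
  ultimately have "?J \<inter> draw (F - {e}) = path_image q" using q(4) by blast
  then have "connected (?J \<inter> draw (F - {e}))"
    using q(1) by (simp add: arc_imp_path connected_path_image)
  moreover have "compact ?J" using q(1) arc_edge[OF eE] by (simp add: compact_Un compact_arc_image)
  moreover have "closed (draw (F - {e}))" using compact_draw[OF F'] by (rule compact_imp_closed)
  ultimately have "connected_component (- (?J \<union> draw (F - {e}))) a b"
    using assms(7,8) by (intro Janiszewski[of ?J])
  moreover have "?J \<union> draw (F - {e}) = draw F"
    using q(4) draw_insert[of e "F - {e}"] F(2) by (auto simp: insert_absorb)
  ultimately show ?thesis by simp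
qed

text \<open>Since \<open>e\<close> meets the drawing of \<open>F\<close> only in its ends, and
  \<open>q\<close> lies in that drawing, the two arcs share only end points and form a Jordan
  curve.\<close>

lemma cycle_loop:
  assumes F: "F \<subseteq> E" "e \<in> E" "e \<notin> F"
    and q: "arc q" "pathstart q = pathfinish (\<gamma> e)" "pathfinish q = pathstart (\<gamma> e)"
      "path_image q \<subseteq> draw F"
  shows "simple_path (\<gamma> e +++ q)" "pathfinish (\<gamma> e +++ q) = pathstart (\<gamma> e +++ q)"
    "path_image (\<gamma> e +++ q) = path_image (\<gamma> e) \<union> path_image q"
proof -
  have "path_image (\<gamma> e) \<inter> path_image q \<subseteq> {pathstart (\<gamma> e), pathstart q}"
    using edge_Int_draw[OF F] q pos_edge[OF F(2)] by auto
  then show "simple_path (\<gamma> e +++ q)"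
    using q arc_edge[OF F(2)] by (intro simple_path_join_loop) auto
  show "pathfinish (\<gamma> e +++ q) = pathstart (\<gamma> e +++ q)" using q by simp
  show "path_image (\<gamma> e +++ q) = path_image (\<gamma> e) \<union> path_image q"
    using q by (simp add: path_image_join)
qed

text \<open>An inner point of \<open>e\<close> has a ball around it that avoids all other edges.
  This ball meets the face of \<open>r\<close>, so once \<open>e\<close> is deleted that face
  extends to the point.\<close>

lemma touches_connected:
  assumes F: "F \<subseteq> E" "e \<in> F" and t: "touches F r e"
  obtains x where "x \<in> inner_edge e" "connected_component (- draw (F - {e})) r x"
proof -
  have F': "F - {e} \<subseteq> E" and eE: "e \<in> E" using F by auto
  obtain x where x: "x \<in> inner_edge e" "x \<in> closure (connected_component_set (- draw F) r)"
    using t by (auto simp: touches_def)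
  have "x \<in> - draw (F - {e})" using inner_edge_Int_draw[OF F' eE] x by blast
  then obtain d where d: "d > 0" "ball x d \<subseteq> - draw (F - {e})"
    using open_Compl_draw[OF F'] by (meson open_contains_ball)
  obtain c where c: "connected_component (- draw F) r c" "dist c x < d"
    using x(2) d(1) by (metis closure_approachable mem_Collect_eq)
  have "connected_component (- draw (F - {e})) r c"
    using connected_component_draw_mono[OF c(1)] by blast
  moreover have "connected_component (- draw (F - {e})) c x"
    unfolding connected_component_def using c(2) d
    by (intro exI[of _ "ball x d"]) (simp add: dist_commute)
  ultimately show ?thesis using that x(1) connected_component_trans by metis
qed

text \<open>Deleting \<open>e\<close> merges all faces that touch it. By \<open>same_face\<close>,
  two of them on the same side of the Jordan curve through \<open>e\<close> are equal, and the curve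
  has only two sides.\<close>

lemma cycle_edge_touches_two_faces:
  assumes F: "F \<subseteq> E" "is_cycle V F cs" "e \<in> cycle_edges cs"
    and R: "in_distinct_faces F R" "finite R"
  shows "card {r \<in> R. touches F r e} \<le> 2"
proof -
  have eF: "e \<in> F" using F by (auto simp: is_cycle_iff_cycle_edges)
  have F': "F - {e} \<subseteq> E" and eE: "e \<in> E" using F eF by auto
  obtain q where q: "arc q" "pathstart q = pathfinish (\<gamma> e)" "pathfinish q = pathstart (\<gamma> e)"
    "path_image q \<subseteq> draw (F - {e})"
    using cycle_arc[OF F] .
  let ?J = "path_image (\<gamma> e) \<union> path_image q"
  have J: "simple_path (\<gamma> e +++ q)" "pathfinish (\<gamma> e +++ q) = pathstart (\<gamma> e +++ q)"
    "path_image (\<gamma> e +++ q) = ?J"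
    using cycle_loop[OF F' eE _ q] by auto
  note jordan = Jordan_inside_outside[OF J(1,2), unfolded J(3)]
  let ?T = "{r \<in> R. touches F r e}"
  have JF: "?J \<subseteq> draw F" using edge_subset_draw[OF eF] q(4) draw_mono[of "F - {e}" F] by blast
  \<comment> \<open>\<open>S\<close> stands for the inside or the outside of the curve.\<close>
  have one: "r = r'" if "r \<in> ?T" "r' \<in> ?T" "r \<in> S" "r' \<in> S" "connected S" "S \<subseteq> - ?J" for r r' S
  proof -
    have t: "touches F r e" "touches F r' e" using that by auto
    obtain x where x: "x \<in> inner_edge e" "connected_component (- draw (F - {e})) r x"
      using touches_connected[OF F(1) eF t(1)] .
    obtain x' where x': "x' \<in> inner_edge e" "connected_component (- draw (F - {e})) r' x'"
      using touches_connected[OF F(1) eF t(2)] .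
    \<comment> \<open>The inner part of \<open>e\<close> is itself a connected link between the two
      faces after the deletion.\<close>
    have "connected_component (- draw (F - {e})) x x'"
      unfolding connected_component_def
      using inner_edge_Int_draw[OF F' eE] connected_inner_edge[OF eE] x(1) x'(1) by blast
    then have "connected_component (- draw (F - {e})) r r'"
      using x(2) x'(2) by (meson connected_component_sym connected_component_trans)
    moreover have "connected_component (- ?J) r r'"
      unfolding connected_component_def using that by blast
    ultimately have "connected_component (- draw F) r r'"
      using same_face[OF F(1) eF q] by blast
    then show ?thesis using R that by (auto simp: in_distinct_faces_def)
  qed
  have side: "card (?T \<inter> S) \<le> 1" if S: "connected S" "S \<subseteq> - ?J" for S
  proof -
    have "\<forall>r \<in> ?T \<inter> S. \<forall>r' \<in> ?T \<inter> S. r = r'"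
      by (intro ballI one[OF _ _ _ _ S]) simp_all
    then show ?thesis using R(2) by (simp add: card_le_Suc0_iff_eq)
  qed
  have in_out: "inside ?J \<union> outside ?J = - ?J" using jordan by blast
  then have sides: "inside ?J \<subseteq> - ?J" "outside ?J \<subseteq> - ?J" by blast+
  have "?T \<subseteq> (?T \<inter> inside ?J) \<union> (?T \<inter> outside ?J)"
    using R(1) JF in_out unfolding in_distinct_faces_def by blast
  then have "card ?T \<le> card ((?T \<inter> inside ?J) \<union> (?T \<inter> outside ?J))"
    using R(2) by (intro card_mono) auto
  also have "\<dots> \<le> card (?T \<inter> inside ?J) + card (?T \<inter> outside ?J)"
    by (rule card_Un_le)
  also have "\<dots> \<le> 1 + 1"
  proof (rule add_mono)
    show "card (?T \<inter> inside ?J) \<le> 1" using jordan by (intro side[OF _ sides(1)]) simp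
    show "card (?T \<inter> outside ?J) \<le> 1" using jordan by (intro side[OF _ sides(2)]) simp
  qed
  finally show ?thesis by simp
qed

text \<open>Otherwise the touching edges \<open>S\<close> form a forest, which does not separate the
  plane. Away from the vertices the face \<open>C\<close> of \<open>r\<close> is open and closed in
  the complement of \<open>draw S\<close>, so it fills this complement up to finitely many points
  and runs into the face of \<open>r'\<close>.\<close>

lemma face_touches_cycle:
  assumes F: "F \<subseteq> E" and R: "in_distinct_faces F R" and r: "r \<in> R" "r' \<in> R" "r \<noteq> r'"
  shows "\<exists>cs. is_cycle V F cs \<and> (\<forall>e \<in> cycle_edges cs. touches F r e)"
proof (rule ccontr)
  assume no_cycle: "\<not> ?thesis"
  define S where "S = {e \<in> F. touches F r e}"
  have SF: "S \<subseteq> F" by (auto simp: S_def)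
  have "acyclic_graph V S"
    using no_cycle unfolding acyclic_graph_def is_cycle_iff_cycle_edges S_def by blast
  then have con: "connected (- draw S)" using connected_Compl_forest SF F by (metis subset_trans)
  have op: "open (- draw S)" using open_Compl_draw SF F by (metis subset_trans)
  have fin: "finite (pos ` V)" using simple by (simp add: simple_graph_def)
  \<comment> \<open>With the vertices removed, a point of \<open>closure C\<close> on an edge is an
    inner point of it; that edge then belongs to \<open>S\<close> and is already cut out. Deleting
    finitely many points keeps the open set connected.\<close>
  define U where "U = - draw S - pos ` V"
  define C where "C = connected_component_set (- draw F) r"
  have openC: "open C" unfolding C_def using open_Compl_draw[OF F] by (rule open_connected_component)
  have CF: "C \<subseteq> - draw F" unfolding C_def by (rule connected_component_subset)
  have rF: "r \<in> - draw F" "r' \<in> - draw F" using R r by (auto simp: in_distinct_faces_def)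
  have FS: "- draw F \<subseteq> - draw S" using draw_mono[OF SF] by blast
  have "connected U"
    unfolding U_def by (rule connected_open_delete_finite) (use op con fin in auto)
  \<comment> \<open>A nonempty open set is infinite and cannot consist of vertices only.\<close>
  have U_ball: "B \<inter> U \<noteq> {}" if "open B" "B \<noteq> {}" "B \<subseteq> - draw F" for B
  proof
    assume "B \<inter> U = {}"
    then have "B \<subseteq> pos ` V" using that FS unfolding U_def by blast
    then have "finite B" using fin finite_subset by blast
    then show False using that finite_imp_not_open by blast
  qed
  have "C \<inter> U \<noteq> {}"
  proof (rule U_ball)
    show "C \<noteq> {}" using rF connected_component_eq_empty[of "- draw F" r] unfolding C_def by blast
  qed (use openC CF in auto)
  moreover have "closure C \<inter> U \<subseteq> C"
  proof
    fix x assume x: "x \<in> closure C \<inter> U"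
    have "x \<notin> draw F"
    proof
      assume "x \<in> draw F"
      then obtain e where e: "e \<in> F" "x \<in> path_image (\<gamma> e)" by (auto simp: draw_def)
      then have "e \<subseteq> V" using F simple by (auto simp: simple_graph_def)
      then have "x \<in> inner_edge e" using e x by (auto simp: inner_edge_def U_def)
      then have "e \<in> S" using e x by (auto simp: S_def touches_def C_def)
      then show False using x e by (auto simp: U_def draw_def)
    qed
    have "closedin (top_of_set (- draw F)) C"
      unfolding C_def by (rule closedin_connected_component)
    then obtain T where "closed T" "C = - draw F \<inter> T" by (auto simp: closedin_closed)
    moreover from this have "closure C \<subseteq> T" by (intro closure_minimal) auto
    ultimately show "x \<in> C" using x \<open>x \<notin> draw F\<close> by auto
  qed
  ultimately have UC: "U \<subseteq> C"
  proof -
    assume a: "C \<inter> U \<noteq> {}" and b: "closure C \<inter> U \<subseteq> C"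
    have "closedin (top_of_set U) (C \<inter> U)"
      using b closure_subset[of C] by (auto simp: closedin_closed intro!: exI[of _ "closure C"])
    moreover have "openin (top_of_set U) (C \<inter> U)"
      using openC by (auto simp: openin_open intro!: exI[of _ C])
    ultimately show ?thesis using \<open>connected U\<close> a by (auto simp: connected_clopen)
  qed
  have "connected_component_set (- draw F) r' \<inter> U \<noteq> {}"
  proof (rule U_ball)
    show "open (connected_component_set (- draw F) r')"
      using open_Compl_draw[OF F] by (rule open_connected_component)
    show "connected_component_set (- draw F) r' \<noteq> {}"
      using rF connected_component_eq_empty[of "- draw F" r'] by blast
  qed (rule connected_component_subset)
  then obtain y where "connected_component (- draw F) r' y" "y \<in> C" using UC by blast
  then have "connected_component (- draw F) r r'"
    unfolding C_def by (metis connected_component_sym connected_component_trans mem_Collect_eq)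
  then show False using R r by (auto simp: in_distinct_faces_def)
qed

text \<open>The new edge closes a Jordan curve inside the drawing. The old face \<open>D\<close>
  crossed by \<open>e\<close> meets both sides of the curve, so its sample point, if any, is
  exchanged for \<open>a\<close> inside and \<open>b\<close> outside; the points in other faces
  remain.\<close>

lemma add_edge_splits_face:
  assumes F: "F \<subseteq> E" "e \<in> E" "e \<notin> F" and cyc: "is_cycle V (insert e F) cs" "e \<in> cycle_edges cs"
    and R: "in_distinct_faces F R" "finite R"
  shows "\<exists>R'. in_distinct_faces (insert e F) R' \<and> finite R' \<and> card R + 1 \<le> card R'"
proof -
  have "insert e F \<subseteq> E" "insert e F - {e} = F" using F by auto
  then obtain q where q: "arc q" "pathstart q = pathfinish (\<gamma> e)" "pathfinish q = pathstart (\<gamma> e)"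
    "path_image q \<subseteq> draw F"
    using cycle_arc[OF _ cyc] by metis
  let ?J = "path_image (\<gamma> e) \<union> path_image q"
  have J: "simple_path (\<gamma> e +++ q)" "pathfinish (\<gamma> e +++ q) = pathstart (\<gamma> e +++ q)"
    "path_image (\<gamma> e +++ q) = ?J"
    using cycle_loop[OF F q] by auto
  note jordan = Jordan_inside_outside[OF J(1,2), unfolded J(3)]
  have JF: "?J \<subseteq> draw (insert e F)" using q(4) by (auto simp: draw_insert)
  obtain x where x: "x \<in> inner_edge e" using inner_edge_nonempty[OF F(2)] by blast
  have xF: "x \<in> - draw F" using inner_edge_Int_draw[OF F] x by blast
  have xJ: "x \<in> ?J" using x by (auto simp: inner_edge_def)
  define D where "D = connected_component_set (- draw F) x"
  have openD: "open D" unfolding D_def using open_Compl_draw[OF F(1)] by (rule open_connected_component)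
  have xD: "x \<in> D" using xF by (simp add: D_def)
  have DF: "D \<subseteq> - draw F" unfolding D_def by (rule connected_component_subset)
  \<comment> \<open>The point \<open>x\<close> of \<open>e\<close> is on the frontier of each side,
    and \<open>D\<close> is an open neighbourhood of \<open>x\<close>.\<close>
  have DS: "S \<inter> D \<noteq> {}" if "frontier S = ?J" for S
  proof -
    have "x \<in> closure S" using xJ that by (auto simp: frontier_def)
    then show ?thesis using openD xD by (metis closure_iff_nhds_not_empty Int_commute order_refl)
  qed
  obtain a where a: "a \<in> inside ?J" "a \<in> D" using DS[of "inside ?J"] jordan by blast
  obtain b where b: "b \<in> outside ?J" "b \<in> D" using DS[of "outside ?J"] jordan by blast
  have edgeD: "path_image (\<gamma> e) \<subseteq> D \<union> draw F"
  proof -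
    have "inner_edge e \<subseteq> D"
      unfolding D_def
      by (rule connected_component_maximal)
        (use x inner_edge_Int_draw[OF F] connected_inner_edge[OF F(2)] in auto)
    moreover have "pos ` e \<subseteq> draw F"
      using q(2,3,4) pos_edge[OF F(2)]
      by (metis insert_subset empty_subsetI pathfinish_in_path_image pathstart_in_path_image subsetD)
    ultimately show ?thesis by (auto simp: inner_edge_def)
  qed
  define R0 where "R0 = R - D"
  have finR0: "finite R0" using R by (simp add: R0_def)
  have "card (R \<inter> D) \<le> 1"
  proof -
    have "r = r'" if "r \<in> R \<inter> D" "r' \<in> R \<inter> D" for r r'
    proof -
      have "connected_component (- draw F) r r'" using that unfolding D_def
        by (metis IntD2 connected_component_sym connected_component_trans mem_Collect_eq)
      then show ?thesis using R that by (auto simp: in_distinct_faces_def)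
    qed
    then show ?thesis using R by (simp add: card_le_Suc0_iff_eq)
  qed
  \<comment> \<open>Discarding the points in \<open>D\<close> costs at most one, and
    \<open>a\<close>, \<open>b\<close> bring two.\<close>
  then have cardR: "card R \<le> card R0 + 1"
    unfolding R0_def using card_Diff_subset_Int[of R D] R card_mono[of R "R \<inter> D"] by simp
  have aJ: "a \<notin> ?J" and bJ: "b \<notin> ?J" using a b jordan by blast+
  have notin: "R0 \<subseteq> - draw (insert e F)" "a \<notin> draw (insert e F)" "b \<notin> draw (insert e F)"
    using R(1) edgeD DF a b aJ bJ by (auto simp: R0_def in_distinct_faces_def draw_insert)
  have mono: "connected_component (- draw F) r r'" if "connected_component (- draw (insert e F)) r r'" for r r'
    using connected_component_draw_mono[OF that] by blast
  have ab: "\<not> connected_component (- draw (insert e F)) a b"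
  proof
    assume "connected_component (- draw (insert e F)) a b"
    then obtain S where S: "connected S" "S \<subseteq> - draw (insert e F)" "a \<in> S" "b \<in> S"
      by (auto simp: connected_component_def)
    have "S \<subseteq> inside ?J \<union> outside ?J" using S JF jordan by blast
    then show False
      using connectedD[OF S(1), of "inside ?J" "outside ?J"] S a b jordan by blast
  qed
  have Dr: "\<not> connected_component (- draw F) d r" "\<not> connected_component (- draw F) r d"
    if "d \<in> D" "r \<in> R0" for d r
    using that unfolding D_def R0_def
    by (metis DiffD2 connected_component_sym connected_component_trans mem_Collect_eq)+
  have "in_distinct_faces (insert e F) (insert a (insert b R0))"
    unfolding in_distinct_faces_def
  proof (intro conjI ballI impI)
    show "insert a (insert b R0) \<subseteq> - draw (insert e F)" using notin by blast
    fix r r' assume rr: "r \<in> insert a (insert b R0)" "r' \<in> insert a (insert b R0)"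
      and con: "connected_component (- draw (insert e F)) r r'"
    have "\<not> connected_component (- draw (insert e F)) b a"
      using ab connected_component_sym by metis
    moreover have "r = r'" if "r \<in> R0" "r' \<in> R0"
      using R(1) mono[OF con] that by (auto simp: in_distinct_faces_def R0_def)
    ultimately show "r = r'" using rr con ab mono[OF con] Dr a(2) b(2) by blast
  qed
  moreover have "card (insert a (insert b R0)) = card R0 + 2"
  proof -
    have "a \<notin> R0" "b \<notin> R0" using a b by (auto simp: R0_def)
    moreover have "a \<noteq> b" using a b jordan by blast
    ultimately show ?thesis using finR0 by simp
  qed
  ultimately show ?thesis using cardR finR0
    by (intro exI[of _ "insert a (insert b R0)"]) simp
qed

section \<open>Euler's inequality and the edge bound from the girth\<close>

text \<open>One half of Euler's formula: a maximal forest has at most \<open>card V - 1\<close>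
  edges and leaves at least one face, and each of the other edges lies on a cycle with the forest
  and so adds a face.\<close>

lemma many_faces:
  assumes "V \<noteq> {}"
  obtains R where "in_distinct_faces E R" "finite R" "card E + 2 \<le> card R + card V"
proof -
  obtain F where F: "F \<subseteq> E" "acyclic_graph V F"
    "\<And>e. e \<in> E - F \<Longrightarrow> \<exists>cs. is_cycle V (insert e F) cs \<and> e \<in> cycle_edges cs"
    using maximal_acyclic_subgraph[OF finite_edges] by metis
  have sgF: "simple_graph V F" using simple F(1) by (rule simple_graph_subset)
  have "\<exists>R. in_distinct_faces (F \<union> A) R \<and> finite R \<and> card A + 1 \<le> card R"
    if "finite A" "A \<subseteq> E - F" for A
    using that
  proof (induction A)
    case empty
    have "draw F \<noteq> UNIV" using compact_draw[OF F(1)] not_compact_UNIV by metis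
    then obtain p where "p \<notin> draw F" by blast
    then show ?case by (intro exI[of _ "{p}"]) (auto simp: in_distinct_faces_def)
  next
    case (insert e A)
    then obtain R where R: "in_distinct_faces (F \<union> A) R" "finite R" "card A + 1 \<le> card R" by auto
    obtain cs where "is_cycle V (insert e F) cs" "e \<in> cycle_edges cs" using F(3) insert.prems by blast
    moreover from this(1) have "is_cycle V (insert e (F \<union> A)) cs"
      unfolding is_cycle_iff_cycle_edges by blast
    moreover have "F \<union> A \<subseteq> E" "e \<in> E" "e \<notin> F \<union> A" using insert F(1) by auto
    ultimately obtain R' where "in_distinct_faces (insert e (F \<union> A)) R'" "finite R'" "card R + 1 \<le> card R'"
      using add_edge_splits_face R(1,2) by metis
    then show ?case using R(3) insert.hyps by (intro exI[of _ R']) simp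
  qed
  from this[of "E - F"] obtain R where R: "in_distinct_faces E R" "finite R" "card (E - F) + 1 \<le> card R"
    using finite_edges F(1) by (auto simp: Un_absorb1)
  moreover have "card F + 1 \<le> card V" using acyclic_graph_card_edges[OF sgF F(2) assms] .
  moreover have "card (E - F) + card F = card E"
    using F(1) finite_edges by (metis card_Diff_subset card_mono finite_subset le_add_diff_inverse2)
  ultimately show ?thesis using that by fastforce
qed

text \<open>Each face chooses a cycle among the edges touching it. Counting pairs of a face and an
  edge of its cycle gives at least \<open>g\<close> per face and at most 2 per edge; Euler's
  inequality then eliminates the number of faces.\<close>

lemma girth_edge_bound:
  assumes "girth_at_least V E g" "V \<noteq> {}" "card V \<le> card E"
  shows "g * (card E + 2) \<le> 2 * card E + g * card V"
proof -
  obtain R where R: "in_distinct_faces E R" "finite R" "card E + 2 \<le> card R + card V"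
    using many_faces[OF assms(2)] .
  have "\<exists>cs. is_cycle V E cs \<and> (\<forall>e \<in> cycle_edges cs. touches E r e)" if "r \<in> R" for r
  proof -
    \<comment> \<open>\<open>card V \<le> card E\<close> yields at least two sample points, hence
      the second face that \<open>face_touches_cycle\<close> asks for.\<close>
    have "card (R - {r}) \<ge> 1" using R(3) assms(3) that R(2) by simp
    then obtain r' where "r' \<in> R" "r \<noteq> r'"
      by (metis DiffE card.empty ex_in_conv insertI1 not_one_le_zero)
    then show ?thesis using face_touches_cycle[OF subset_refl R(1) that] by blast
  qed
  then obtain c where c: "\<And>r. r \<in> R \<Longrightarrow> is_cycle V E (c r)"
    "\<And>r e. r \<in> R \<Longrightarrow> e \<in> cycle_edges (c r) \<Longrightarrow> touches E r e" by metis
  have sub: "cycle_edges (c r) \<subseteq> E" if "r \<in> R" for r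
    using c(1)[OF that] by (simp add: is_cycle_iff_cycle_edges)
  have "g * card R \<le> (\<Sum>r\<in>R. card (cycle_edges (c r)))"
  proof -
    have "g \<le> card (cycle_edges (c r))" if "r \<in> R" for r
      using c(1)[OF that] assms(1) card_cycle_edges[of "c r"]
      by (auto simp: girth_at_least_def is_cycle_def)
    then have "(\<Sum>r\<in>R. g) \<le> (\<Sum>r\<in>R. card (cycle_edges (c r)))" by (intro sum_mono)
    then show ?thesis by (simp add: mult.commute)
  qed
  also have "\<dots> = (\<Sum>r\<in>R. \<Sum>e\<in>E. if e \<in> cycle_edges (c r) then 1 else 0)"
    using sub finite_edges by (intro sum.cong refl) (simp add: sum.If_cases Int_absorb1 inf_commute)
  also have "\<dots> = (\<Sum>e\<in>E. \<Sum>r\<in>R. if e \<in> cycle_edges (c r) then 1 else 0)"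
    by (rule sum.swap)
  also have "\<dots> = (\<Sum>e\<in>E. card {r \<in> R. e \<in> cycle_edges (c r)})"
    using R(2) by (intro sum.cong refl) (simp add: sum.If_cases Int_def)
  also have "\<dots> \<le> (\<Sum>e\<in>E. 2)"
  proof (rule sum_mono)
    fix e assume "e \<in> E"
    let ?T = "{r \<in> R. e \<in> cycle_edges (c r)}"
    show "card ?T \<le> 2"
    proof (cases "?T = {}")
      case False
      then obtain r where r: "r \<in> R" "e \<in> cycle_edges (c r)" by blast
      have "card ?T \<le> card {r \<in> R. touches E r e}"
        using c(2) R(2) by (intro card_mono) auto
      also have "\<dots> \<le> 2"
        using cycle_edge_touches_two_faces[OF subset_refl c(1)[OF r(1)] r(2) R(1,2)] .
      finally show ?thesis .
    next
      case True
      then show ?thesis by (metis card.empty le0)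
    qed
  qed
  also have "\<dots> = 2 * card E" by simp
  finally have "g * card R \<le> 2 * card E" .
  moreover have "g * (card E + 2) \<le> g * (card R + card V)" using R(3) by (rule mult_le_mono2)
  ultimately show ?thesis by (simp add: add_mult_distrib2)
qed

end

section \<open>Transfer of the drawing to the complex plane\<close>

lemma planar_imp_plane_graph:
  fixes V :: "'v set"
  assumes "simple_graph V E" "planar V E"
  obtains pos \<gamma> where "plane_graph V E pos \<gamma>"
proof -
  obtain p :: "'v \<Rightarrow> real^2" and c where
    edges: "\<And>e. e \<in> E \<Longrightarrow> \<exists>u v. e = {u, v} \<and> arc (c e) \<and> pathstart (c e) = p u \<and> pathfinish (c e) = p v"
    and disj: "\<And>e e'. e \<in> E \<Longrightarrow> e' \<in> E \<Longrightarrow> e \<noteq> e' \<Longrightarrow> path_image (c e) \<inter> path_image (c e') \<subseteq> p ` (e \<inter> e')"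
    using assms(2) unfolding planar_def by metis
  \<comment> \<open>The coordinatewise identification; being linear and injective, it preserves arcs
    and intersections.\<close>
  define h :: "real^2 \<Rightarrow> complex" where "h x = Complex (x $ 1) (x $ 2)" for x
  have lin: "linear h"
    by (rule linearI) (auto simp: h_def complex_eq_iff)
  have inj: "inj h"
    by (rule injI) (auto simp: h_def vec_eq_iff forall_2)
  have "plane_graph V E (h \<circ> p) (\<lambda>e. h \<circ> c e)"
  proof
    fix e assume "e \<in> E"
    then show "\<exists>u v. e = {u, v} \<and> arc (h \<circ> c e) \<and> pathstart (h \<circ> c e) = (h \<circ> p) u \<and> pathfinish (h \<circ> c e) = (h \<circ> p) v"
      using edges[of e] arc_linear_image_eq[OF lin inj, of "c e"]
      by (simp add: pathstart_compose pathfinish_compose) metis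
  next
    fix e e' assume "e \<in> E" "e' \<in> E" "e \<noteq> e'"
    then have "h ` (path_image (c e) \<inter> path_image (c e')) \<subseteq> h ` p ` (e \<inter> e')"
      using disj by (intro image_mono)
    then show "path_image (h \<circ> c e) \<inter> path_image (h \<circ> c e') \<subseteq> (h \<circ> p) ` (e \<inter> e')"
      by (simp only: path_image_compose image_comp image_Int[OF inj])
  qed (rule assms(1))
  with that show ?thesis .
qed

section \<open>Pairs of disjoint colours\<close>

definition states :: "'c set \<Rightarrow> ('c \<times> 'c) set" where
  "states X = {(a, b). a \<in> X \<and> b \<in> X \<and> a \<noteq> b}"

definition compatible :: "'c set set \<Rightarrow> 'c \<times> 'c \<Rightarrow> 'c \<times> 'c \<Rightarrow> bool" where
  "compatible EH s t \<longleftrightarrow> {fst s, fst t} \<notin> EH \<and> {snd s, snd t} \<notin> EH"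

definition matched :: "'c set set \<Rightarrow> 'c set \<Rightarrow> 'c set \<Rightarrow> bool" where
  "matched EH X Y \<longleftrightarrow>
     (\<forall>x\<in>X. \<forall>y\<in>Y. \<forall>y'\<in>Y. {x, y} \<in> EH \<longrightarrow> {x, y'} \<in> EH \<longrightarrow> y = y') \<and>
     (\<forall>y\<in>Y. \<forall>x\<in>X. \<forall>x'\<in>X. {x, y} \<in> EH \<longrightarrow> {x', y} \<in> EH \<longrightarrow> x = x')"

lemma compatible_sym: "compatible EH s t \<longleftrightarrow> compatible EH t s"
  by (simp add: compatible_def insert_commute)

lemma card_states:
  assumes "card X = 3"
  shows "finite (states X)" "card (states X) = 6"
proof -
  obtain x y z where X: "X = {x, y, z}" "x \<noteq> y" "y \<noteq> z" "x \<noteq> z"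
    using assms by (auto simp: card_3_iff)
  then have "states X = {(x, y), (x, z), (y, x), (y, z), (z, x), (z, y)}"
    by (auto simp: states_def)
  then show "finite (states X)" "card (states X) = 6" using X by auto
qed

text \<open>\<open>p\<close> and \<open>q\<close> are the partners of \<open>a\<close> and \<open>b\<close>; missing partners are chosen arbitrarily.\<close>
lemma matched_targets:
  assumes "matched EH X Y" "card Y = 3" "(a, b) \<in> states X"
  obtains p q r where "Y = {p, q, r}" "p \<noteq> q" "q \<noteq> r" "p \<noteq> r"
    "\<forall>c\<in>Y. {a, c} \<in> EH \<longrightarrow> c = p" "\<forall>c\<in>Y. {b, c} \<in> EH \<longrightarrow> c = q"
proof -
  have ab: "a \<in> X" "b \<in> X" "a \<noteq> b" using assms(3) by (auto simp: states_def)
  have finY: "finite Y" using assms(2) by (simp add: card_ge_0_finite)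
  have other: "\<exists>q \<in> Y. q \<noteq> p" for p
    using assms(2) finY by (metis card_le_Suc0_iff_eq One_nat_def Suc_1 Suc_n_not_le_n numeral_3_eq_3 le_SucI)
  have "\<exists>p q. p \<in> Y \<and> q \<in> Y \<and> p \<noteq> q \<and> (\<forall>c\<in>Y. {a, c} \<in> EH \<longrightarrow> c = p) \<and> (\<forall>c\<in>Y. {b, c} \<in> EH \<longrightarrow> c = q)"
  proof (cases "\<exists>p\<in>Y. {a, p} \<in> EH")
    case True
    then obtain p where p: "p \<in> Y" "{a, p} \<in> EH" by blast
    then have pu: "\<forall>c\<in>Y. {a, c} \<in> EH \<longrightarrow> c = p"
      using assms(1) ab unfolding matched_def by blast
    show ?thesis
    proof (cases "\<exists>q\<in>Y. {b, q} \<in> EH")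
      case True
      then obtain q where q: "q \<in> Y" "{b, q} \<in> EH" by blast
      then have "\<forall>c\<in>Y. {b, c} \<in> EH \<longrightarrow> c = q"
        using assms(1) ab unfolding matched_def by blast
      moreover have "p \<noteq> q" using p q ab assms(1) unfolding matched_def by blast
      ultimately show ?thesis using p q pu by blast
    next
      case False
      with p pu other[of p] show ?thesis by metis
    qed
  next
    case no_p: False
    show ?thesis
    proof (cases "\<exists>q\<in>Y. {b, q} \<in> EH")
      case True
      then obtain q where q: "q \<in> Y" "{b, q} \<in> EH" by blast
      then have "\<forall>c\<in>Y. {b, c} \<in> EH \<longrightarrow> c = q"
        using assms(1) ab unfolding matched_def by blast
      with q no_p other[of q] show ?thesis by metis
    next
      case False
      with no_p other show ?thesis by metis
    qed
  qed
  then obtain p q where pq: "p \<in> Y" "q \<in> Y" "p \<noteq> q"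
    "\<forall>c\<in>Y. {a, c} \<in> EH \<longrightarrow> c = p" "\<forall>c\<in>Y. {b, c} \<in> EH \<longrightarrow> c = q" by blast
  have "card (Y - {p, q}) = 1" using pq(1-3) assms(2) card_Diff_subset[of "{p, q}" Y] by simp
  then obtain r where "Y - {p, q} = {r}" by (auto simp: card_1_singleton_iff)
  then have Y: "Y = {p, q, r}" "q \<noteq> r" "p \<noteq> r" using pq(1,2) by blast+
  show ?thesis using that[OF Y(1) pq(3) Y(2,3) pq(4,5)] .
qed

text \<open>A blocked pair has \<open>p\<close> in its first or \<open>q\<close> in its second
  position, which leaves \<open>(p, q)\<close>, \<open>(p, r)\<close> and
  \<open>(r, q)\<close>.\<close>

lemma card_incompatible:
  assumes "matched EH X Y" "card Y = 3" "s \<in> states X"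
  shows "card {t \<in> states Y. \<not> compatible EH s t} \<le> 3"
proof -
  obtain a b where s: "s = (a, b)" by force
  obtain p q r where pqr: "Y = {p, q, r}" "p \<noteq> q" "q \<noteq> r" "p \<noteq> r"
    "\<forall>c\<in>Y. {a, c} \<in> EH \<longrightarrow> c = p" "\<forall>c\<in>Y. {b, c} \<in> EH \<longrightarrow> c = q"
    using matched_targets[OF assms(1,2) assms(3)[unfolded s]] .
  have "{t \<in> states Y. \<not> compatible EH s t} \<subseteq> {(p, q), (p, r), (r, q)}"
  proof
    fix t assume t: "t \<in> {t \<in> states Y. \<not> compatible EH s t}"
    obtain c d where cd: "t = (c, d)" by force
    have Y: "c \<in> Y" "d \<in> Y" "c \<noteq> d" using t cd by (auto simp: states_def)
    have "c = p \<or> d = q" using t cd Y pqr(5,6) s by (auto simp: compatible_def)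
    then show "t \<in> {(p, q), (p, r), (r, q)}" using Y pqr(1) cd by auto
  qed
  then have "card {t \<in> states Y. \<not> compatible EH s t} \<le> card {(p, q), (p, r), (r, q)}"
    by (intro card_mono) auto
  also have "\<dots> \<le> 3" by (simp add: card_insert_if)
  finally show ?thesis .
qed

text \<open>Of the three pairs \<open>(q, p)\<close>, \<open>(q, r)\<close>, \<open>(r, p)\<close> compatible with \<open>s\<close>, all are
  blocked by \<open>t\<close> only if \<open>t\<close> is the pair of partners of \<open>q\<close> and \<open>p\<close>.\<close>
lemma card_blocked_through_middle:
  assumes XM: "matched EH X M" and MY: "matched EH M Y" and "card M = 3" "finite Y" "s \<in> states X"
  shows "card {t \<in> states Y. \<forall>m \<in> states M. \<not> (compatible EH s m \<and> compatible EH m t)} \<le> 1"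
proof -
  obtain a b where s: "s = (a, b)" by force
  obtain p q r where pqr: "M = {p, q, r}" "p \<noteq> q" "q \<noteq> r" "p \<noteq> r"
    "\<forall>c\<in>M. {a, c} \<in> EH \<longrightarrow> c = p" "\<forall>c\<in>M. {b, c} \<in> EH \<longrightarrow> c = q"
    using matched_targets[OF XM assms(3) assms(5)[unfolded s]] .
  let ?B = "{t \<in> states Y. \<forall>m \<in> states M. \<not> (compatible EH s m \<and> compatible EH m t)}"
  have m: "(q, p) \<in> states M" "(q, r) \<in> states M" "(r, p) \<in> states M"
    using pqr(1-4) by (auto simp: states_def)
  have M: "p \<in> M" "q \<in> M" "r \<in> M" using pqr(1) by auto
  have "{a, q} \<notin> EH" "{a, r} \<notin> EH" "{b, p} \<notin> EH" "{b, r} \<notin> EH"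
    using pqr(2-4) pqr(5)[rule_format, OF M(2)] pqr(5)[rule_format, OF M(3)]
      pqr(6)[rule_format, OF M(1)] pqr(6)[rule_format, OF M(3)] by blast+
  then have ok: "compatible EH s (q, p)" "compatible EH s (q, r)" "compatible EH s (r, p)"
    by (simp_all add: compatible_def s)
  have uM: "x = x'" if "x \<in> M" "x' \<in> M" "y \<in> Y" "{x, y} \<in> EH" "{x', y} \<in> EH" for x x' y
    using MY that unfolding matched_def by blast
  have uY: "y = y'" if "x \<in> M" "y \<in> Y" "y' \<in> Y" "{x, y} \<in> EH" "{x, y'} \<in> EH" for x y y'
    using MY that unfolding matched_def by blast
  have char: "fst t \<in> Y \<and> snd t \<in> Y \<and> {q, fst t} \<in> EH \<and> {p, snd t} \<in> EH" if "t \<in> ?B" for t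
  proof -
    have Y: "fst t \<in> Y" "snd t \<in> Y" using that by (auto simp: states_def)
    have blocked: "\<not> compatible EH m t" if "m \<in> states M" "compatible EH s m" for m
      using \<open>t \<in> ?B\<close> that by blast
    have 1: "{q, fst t} \<in> EH \<or> {p, snd t} \<in> EH" "{q, fst t} \<in> EH \<or> {r, snd t} \<in> EH"
      "{r, fst t} \<in> EH \<or> {p, snd t} \<in> EH"
      using blocked[OF m(1) ok(1)] blocked[OF m(2) ok(2)] blocked[OF m(3) ok(3)]
      unfolding compatible_def fst_conv snd_conv by blast+
    \<comment> \<open>A colour of \<open>Y\<close> has at most one partner in \<open>M\<close>. So
      if either of the two desired edges were missing, the disjunctions would force two partners on
      one coordinate of \<open>t\<close>.\<close>
    have "\<not> ({q, fst t} \<in> EH \<and> {r, fst t} \<in> EH)" "\<not> ({p, snd t} \<in> EH \<and> {r, snd t} \<in> EH)"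
      using uM[OF M(2,3) Y(1)] uM[OF M(1,3) Y(2)] pqr(3,4) by blast+
    with 1 Y show ?thesis by blast
  qed
  have "t = t'" if "t \<in> ?B" "t' \<in> ?B" for t t'
    using uY[OF M(2), of "fst t" "fst t'"] uY[OF M(1), of "snd t" "snd t'"]
      char[OF that(1)] char[OF that(2)] by (simp add: prod_eq_iff)
  moreover have "finite ?B"
  proof -
    have "?B \<subseteq> Y \<times> Y" unfolding states_def by blast
    then show ?thesis using \<open>finite Y\<close> by (meson finite_SigmaI finite_subset)
  qed
  ultimately show ?thesis by (metis (no_types, lifting) One_nat_def card_le_Suc0_iff_eq)
qed

section \<open>Discharging\<close>

definition nbrs :: "'v set set \<Rightarrow> 'v set \<Rightarrow> 'v \<Rightarrow> 'v set" where
  "nbrs E W v = {u \<in> W. {u, v} \<in> E}"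

text \<open>Degrees are taken within \<open>W\<close>, since the induction works with induced
  subgraphs.\<close>

definition nbrs2 :: "'v set set \<Rightarrow> 'v set \<Rightarrow> 'v \<Rightarrow> 'v set" where
  "nbrs2 E W v = {u \<in> nbrs E W v. card (nbrs E W u) = 2}"

lemma simple_graph_induced: "simple_graph V E \<Longrightarrow> W \<subseteq> V \<Longrightarrow> simple_graph W {e \<in> E. e \<subseteq> W}"
  by (auto simp: simple_graph_def intro: finite_subset)

lemma sum_card_nbrs:
  assumes "simple_graph W F"
  shows "(\<Sum>v\<in>W. card (nbrs F W v)) = 2 * card F"
proof -
  have finW: "finite W" using assms by (simp add: simple_graph_def)
  have "card (nbrs F W v) = card {e \<in> F. v \<in> e}" if "v \<in> W" for v
  proof -
    have "(\<lambda>u. {u, v}) ` nbrs F W v = {e \<in> F. v \<in> e}"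
    proof
      show "{e \<in> F. v \<in> e} \<subseteq> (\<lambda>u. {u, v}) ` nbrs F W v"
      proof
        fix e assume e: "e \<in> {e \<in> F. v \<in> e}"
        then obtain u where "e = {v, u}" "u \<in> W"
          using simple_graph_edge_other[OF assms, of e v] by auto
        then show "e \<in> (\<lambda>u. {u, v}) ` nbrs F W v" using e
          by (intro image_eqI[of _ _ u]) (auto simp: nbrs_def insert_commute)
      qed
    qed (auto simp: nbrs_def)
    moreover have "inj_on (\<lambda>u. {u, v}) (nbrs F W v)"
      by (auto simp: inj_on_def doubleton_eq_iff)
    ultimately show ?thesis by (metis card_image)
  qed
  then have "(\<Sum>v\<in>W. card (nbrs F W v)) = (\<Sum>v\<in>W. card {e \<in> F. v \<in> e})" by simp
  also have "\<dots> = 2 * card F"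
  proof (rule sum_multicount)
    show "\<forall>e\<in>F. card {v \<in> W. v \<in> e} = 2"
    proof
      fix e assume "e \<in> F"
      then have "e \<subseteq> W" "card e = 2" using assms by (auto simp: simple_graph_def)
      moreover have "{v \<in> W. v \<in> e} = e" using \<open>e \<subseteq> W\<close> by blast
      ultimately show "card {v \<in> W. v \<in> e} = 2" by simp
    qed
  qed (use finW simple_graph_finite_edges[OF assms] in auto)
  finally show ?thesis .
qed

text \<open>A vertex of degree \<open>d\<close> starts with charge \<open>3 d\<close>, and each vertex of degree 2 takes 1 from each
  of its neighbours; without reducible vertices everybody ends with at least 8.\<close>
lemma discharging:
  assumes sg: "simple_graph W F"
    and irred: "\<And>w. w \<in> W \<Longrightarrow> card (nbrs2 F W w) + 3 * card (nbrs F W w - nbrs2 F W w) \<ge> 6"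
  shows "4 * card W \<le> 3 * card F"
proof -
  have finW: "finite W" using sg by (simp add: simple_graph_def)
  let ?d = "\<lambda>w. card (nbrs F W w)" and ?d2 = "\<lambda>w. card (nbrs2 F W w)"
  let ?T = "{u \<in> W. ?d u = 2}"
  \<comment> \<open>Irreducibility reads \<open>3 d - 2 d2 \<ge> 6\<close>. For
    \<open>d2 \<ge> 2\<close> this suffices; \<open>d2 = 1\<close> forces \<open>d \<ge> 3\<close>;
    and \<open>d2 = 0\<close> forces \<open>d \<ge> 2\<close>, where \<open>d = 2\<close> needs the
    2 units received.\<close>
  have local: "8 + ?d2 w \<le> 3 * ?d w + (if ?d w = 2 then 2 else 0)" if "w \<in> W" for w
  proof -
    have sub: "nbrs2 F W w \<subseteq> nbrs F W w" and fin: "finite (nbrs F W w)"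
      using finW by (auto simp: nbrs2_def nbrs_def)
    have "card (nbrs F W w - nbrs2 F W w) = ?d w - ?d2 w"
      using sub fin by (meson card_Diff_subset finite_subset)
    moreover have "?d2 w \<le> ?d w" using sub fin by (rule card_mono[rotated])
    ultimately show ?thesis using irred[OF that] by auto
  qed
  have "8 * card W + (\<Sum>w\<in>W. ?d2 w) = (\<Sum>w\<in>W. 8 + ?d2 w)" by (simp add: sum.distrib)
  also have "\<dots> \<le> (\<Sum>w\<in>W. 3 * ?d w + (if ?d w = 2 then 2 else 0))"
    using local by (rule sum_mono)
  also have "\<dots> = 3 * (\<Sum>w\<in>W. ?d w) + 2 * card ?T"
    using finW by (simp add: sum.distrib sum_distrib_left sum.If_cases Int_def)
  also have "\<dots> = 6 * card F + 2 * card ?T" using sum_card_nbrs[OF sg] by simp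
  finally have "8 * card W + (\<Sum>w\<in>W. ?d2 w) \<le> 6 * card F + 2 * card ?T" .
  \<comment> \<open>Charge given equals charge received: each vertex of degree 2 is counted once by
    each of its two neighbours.\<close>
  moreover have "(\<Sum>w\<in>W. ?d2 w) = 2 * card ?T"
  proof -
    have "(\<Sum>w\<in>W. card {u \<in> ?T. {u, w} \<in> F}) = 2 * card ?T"
    proof (rule sum_multicount)
      have "{w \<in> W. {u, w} \<in> F} = nbrs F W u" for u by (simp add: nbrs_def insert_commute)
      then show "\<forall>u\<in>?T. card {w \<in> W. {u, w} \<in> F} = 2" by simp
    qed (use finW in auto)
    moreover have "nbrs2 F W w = {u \<in> ?T. {u, w} \<in> F}" for w
      by (auto simp: nbrs2_def nbrs_def)
    ultimately show ?thesis by simp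
  qed
  ultimately show ?thesis by simp
qed

section \<open>Extending partial colourings\<close>

definition proper :: "'v set set \<Rightarrow> ('v \<Rightarrow> 'c set) \<Rightarrow> 'c set set \<Rightarrow> 'v set \<Rightarrow> ('v \<Rightarrow> 'c \<times> 'c) \<Rightarrow> bool" where
  "proper E L EH W s \<longleftrightarrow> (\<forall>v\<in>W. s v \<in> states (L v)) \<and>
     (\<forall>u\<in>W. \<forall>v\<in>W. {u, v} \<in> E \<longrightarrow> compatible EH (s u) (s v))"

text \<open>The cover condition gives uniqueness in one direction; applying it to both orders of the
  edge gives a matching.\<close>

lemma cover_matched:
  assumes "correspondence_cover V E L EH" "u \<in> V" "v \<in> V" "{u, v} \<in> E"
  shows "matched EH (L u) (L v)"
proof -
  have *: "\<And>u v x y y'. \<lbrakk>u \<in> V; v \<in> V; {u, v} \<in> E; x \<in> L u; y \<in> L v; y' \<in> L v; {x, y} \<in> EH; {x, y'} \<in> EH\<rbrakk> \<Longrightarrow> y = y'"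
    using assms(1) unfolding correspondence_cover_def by blast
  show ?thesis unfolding matched_def
    using *[of u v] *[of v u] assms(2-4) by (auto simp: insert_commute)
qed

text \<open>Of the six states of \<open>w\<close>, each neighbour in \<open>?N1\<close> excludes at
  most three and each in \<open>?N2\<close> at most one, so one survives. Without triangles the set
  \<open>?N2\<close> is independent, so its vertices can be coloured one by one afterwards.\<close>

lemma extend_over_reducible_vertex:
  assumes sg: "simple_graph V E"
    and cover: "k_fold_cover 3 V E L EH"
    and no_triangle: "\<And>x y z. \<lbrakk>{x, y} \<in> E; {y, z} \<in> E; {z, x} \<in> E\<rbrakk> \<Longrightarrow> False"
    and W: "W \<subseteq> V" "w \<in> W"
    and reducible: "card (nbrs2 E W w) + 3 * card (nbrs E W w - nbrs2 E W w) \<le> 5"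
    and s: "proper E L EH (W - insert w (nbrs2 E W w)) s"
  shows "\<exists>s'. proper E L EH W s'"
proof -
  have cov: "correspondence_cover V E L EH" and card3: "\<And>v. v \<in> V \<Longrightarrow> card (L v) = 3"
    using cover by (auto simp: k_fold_cover_def)
  have finW: "finite W" using sg W(1) by (auto simp: simple_graph_def intro: finite_subset)
  have irrefl: "{v, v} \<notin> E" for v using sg by (force simp: simple_graph_def)
  let ?N2 = "nbrs2 E W w" and ?N1 = "nbrs E W w - nbrs2 E W w"
  let ?W = "W - insert w ?N2"
  have finN: "finite ?N2" "finite ?N1" using finW by (auto simp: nbrs2_def nbrs_def)
  have N2W: "u \<in> W" "{u, w} \<in> E" if "u \<in> ?N2" for u using that by (auto simp: nbrs2_def nbrs_def)
  have N2_indep: "{u, v} \<notin> E" if "u \<in> ?N2" "v \<in> ?N2" for u v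
    using no_triangle[of u v w] N2W[OF that(1)] N2W[OF that(2)] by (auto simp: insert_commute)
  \<comment> \<open>The neighbour of \<open>u\<close> other than \<open>w\<close> is outside
    \<open>?N2\<close> by independence, hence already coloured by \<open>s\<close>.\<close>
  have "\<exists>x \<in> ?W. {x, u} \<in> E \<and> (\<forall>v \<in> W. {u, v} \<in> E \<longrightarrow> v = w \<or> v = x)" if u: "u \<in> ?N2" for u
  proof -
    have "card (nbrs E W u) = 2" using u by (simp add: nbrs2_def)
    moreover have "w \<in> nbrs E W u" using N2W[OF u] W by (simp add: nbrs_def insert_commute)
    ultimately have "card (nbrs E W u - {w}) = 1" by simp
    then obtain x where "nbrs E W u - {w} = {x}" by (auto simp: card_1_singleton_iff)
    with \<open>w \<in> nbrs E W u\<close> have x: "nbrs E W u = {w, x}" "x \<noteq> w" by blast+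
    then have "x \<in> W" "{x, u} \<in> E" by (auto simp: nbrs_def)
    moreover have "x \<notin> ?N2" using N2_indep[OF _ u] \<open>{x, u} \<in> E\<close> by blast
    moreover have "\<forall>v \<in> W. {u, v} \<in> E \<longrightarrow> v \<in> nbrs E W u" by (auto simp: nbrs_def insert_commute)
    ultimately show ?thesis using x by blast
  qed
  then obtain x where x: "\<And>u. u \<in> ?N2 \<Longrightarrow> x u \<in> ?W" "\<And>u. u \<in> ?N2 \<Longrightarrow> {x u, u} \<in> E"
    "\<And>u v. u \<in> ?N2 \<Longrightarrow> v \<in> W \<Longrightarrow> {u, v} \<in> E \<Longrightarrow> v = w \<or> v = x u" by metis
  define bad1 where "bad1 u = {t \<in> states (L w). \<not> compatible EH (s u) t}" for u
  \<comment> \<open>States of \<open>w\<close> that would leave no state for the still uncoloured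
    \<open>u\<close>.\<close>
  define bad2 where "bad2 u = {t \<in> states (L w).
    \<forall>m \<in> states (L u). \<not> (compatible EH (s (x u)) m \<and> compatible EH m t)}" for u
  have bad1: "card (bad1 u) \<le> 3" if "u \<in> ?N1" for u
  proof -
    have u: "u \<in> W" "{u, w} \<in> E" "u \<in> ?W" using that irrefl by (auto simp: nbrs_def)
    have "s u \<in> states (L u)" using s u by (simp add: proper_def)
    then show ?thesis unfolding bad1_def
      using cover_matched[OF cov _ _ u(2)] card3 u W by (intro card_incompatible) auto
  qed
  have bad2: "card (bad2 u) \<le> 1" if "u \<in> ?N2" for u
  proof -
    have xu: "x u \<in> V" using x(1)[OF that] W by blast
    have uV: "u \<in> V" and wV: "w \<in> V" using N2W[OF that] W by auto
    have "s (x u) \<in> states (L (x u))" using s x(1)[OF that] by (simp add: proper_def)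
    then show ?thesis unfolding bad2_def
      using cover_matched[OF cov xu uV x(2)[OF that]] cover_matched[OF cov uV wV N2W(2)[OF that]]
        card3[OF uV] card3[OF wV] by (intro card_blocked_through_middle) (auto simp: card_ge_0_finite)
  qed
  have "card ((\<Union>u\<in>?N1. bad1 u) \<union> (\<Union>u\<in>?N2. bad2 u)) \<le> card (\<Union>u\<in>?N1. bad1 u) + card (\<Union>u\<in>?N2. bad2 u)"
    by (rule card_Un_le)
  also have "\<dots> \<le> (\<Sum>u\<in>?N1. card (bad1 u)) + (\<Sum>u\<in>?N2. card (bad2 u))"
    using finN by (intro add_mono card_UN_le)
  also have "\<dots> \<le> (\<Sum>u\<in>?N1. 3) + (\<Sum>u\<in>?N2. 1)"
    using bad1 bad2 by (intro add_mono sum_mono)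
  also have "\<dots> \<le> 5" using reducible by simp
  finally have "card ((\<Union>u\<in>?N1. bad1 u) \<union> (\<Union>u\<in>?N2. bad2 u)) < card (states (L w))"
    using card_states[of "L w"] card3[of w] W by auto
  moreover have "finite ((\<Union>u\<in>?N1. bad1 u) \<union> (\<Union>u\<in>?N2. bad2 u))"
    using finN card_states(1)[of "L w"] card3[of w] W by (auto simp: bad1_def bad2_def)
  ultimately obtain t where t: "t \<in> states (L w)" "t \<notin> (\<Union>u\<in>?N1. bad1 u)" "t \<notin> (\<Union>u\<in>?N2. bad2 u)"
    by (metis UnCI card_mono leD subsetI)
  have "\<exists>m \<in> states (L u). compatible EH (s (x u)) m \<and> compatible EH m t" if "u \<in> ?N2" for u
    using t that unfolding bad2_def by blast
  then obtain m where m: "\<And>u. u \<in> ?N2 \<Longrightarrow> m u \<in> states (L u)"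
    "\<And>u. u \<in> ?N2 \<Longrightarrow> compatible EH (s (x u)) (m u)" "\<And>u. u \<in> ?N2 \<Longrightarrow> compatible EH (m u) t" by metis
  define s' where "s' v = (if v = w then t else if v \<in> ?N2 then m v else s v)" for v
  have wN2: "w \<notin> ?N2" using irrefl by (auto simp: nbrs2_def nbrs_def)
  have s'w: "s' w = t" and s'N2: "\<And>u. u \<in> ?N2 \<Longrightarrow> s' u = m u" and s'W: "\<And>u. u \<in> ?W \<Longrightarrow> s' u = s u"
    using wN2 by (auto simp: s'_def)
  have comp_w: "compatible EH (s' u) t" if "u \<in> W" "{u, w} \<in> E" for u
  proof (cases "u \<in> ?N2")
    case True
    then show ?thesis using m s'N2 by simp
  next
    case False
    then have "u \<in> ?N1" "u \<in> ?W" using that irrefl by (auto simp: nbrs_def)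
    then show ?thesis using t s'W unfolding bad1_def by auto
  qed
  have comp_N2: "compatible EH (s' v) (s' u)" if "u \<in> ?N2" "v \<in> W" "{u, v} \<in> E" for u v
    using x(3)[OF that]
  proof
    assume "v = w"
    then show ?thesis using m(3)[OF that(1)] s'w s'N2[OF that(1)] compatible_sym by metis
  next
    assume "v = x u"
    then show ?thesis using m(2)[OF that(1)] s'N2[OF that(1)] s'W[OF x(1)[OF that(1)]] by simp
  qed
  have "compatible EH (s' u) (s' v)" if uv: "u \<in> W" "v \<in> W" "{u, v} \<in> E" for u v
  proof -
    have vu: "{v, u} \<in> E" using uv by (simp add: insert_commute)
    consider "u = w" | "v = w" | "u \<in> ?N2" | "v \<in> ?N2" | "u \<in> ?W" "v \<in> ?W" using uv by blast
    then show ?thesis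
    proof cases
      case 1
      then show ?thesis using comp_w[OF uv(2)] vu s'w compatible_sym by metis
    next
      case 2
      then show ?thesis using comp_w[OF uv(1)] uv s'w by metis
    next
      case 3
      then show ?thesis using comp_N2[OF _ uv(2,3)] compatible_sym by metis
    next
      case 4
      then show ?thesis using comp_N2[OF _ uv(1) vu] by simp
    next
      case 5
      then show ?thesis using s uv(3) s'W by (simp add: proper_def)
    qed
  qed
  moreover have "s' v \<in> states (L v)" if "v \<in> W" for v
    using that t(1) m(1) s by (auto simp: s'_def proper_def)
  ultimately have "proper E L EH W s'" by (simp add: proper_def)
  then show ?thesis by blast
qed

section \<open>Induction over induced subgraphs and conclusion\<close>

lemma plane_graph_subgraph:
  assumes "plane_graph V E pos \<gamma>" "simple_graph W F" "F \<subseteq> E"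
  shows "plane_graph W F pos \<gamma>"
proof -
  interpret plane_graph V E pos \<gamma> by fact
  show ?thesis
  proof
    fix e e' assume "e \<in> F"
    then show "\<exists>u v. e = {u, v} \<and> arc (\<gamma> e) \<and> pathstart (\<gamma> e) = pos u \<and> pathfinish (\<gamma> e) = pos v"
      using edge_arc assms(3) by blast
    assume "e' \<in> F" "e \<noteq> e'"
    then show "path_image (\<gamma> e) \<inter> path_image (\<gamma> e') \<subseteq> pos ` (e \<inter> e')"
      using edges_disjoint \<open>e \<in> F\<close> assms(3) by (meson subsetD)
  qed fact
qed

lemma girth_at_least_subgraph:
  "girth_at_least V E g \<Longrightarrow> W \<subseteq> V \<Longrightarrow> F \<subseteq> E \<Longrightarrow> girth_at_least W F g"
  unfolding girth_at_least_def is_cycle_iff_cycle_edges by (meson subset_trans)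

lemma girth_ge_4_triangle_free:
  assumes "simple_graph V E" "girth_at_least V E g" "g \<ge> 4"
    and xyz: "{x, y} \<in> E" "{y, z} \<in> E" "{z, x} \<in> E"
  shows False
proof -
  have "card e = 2" "e \<subseteq> V" if "e \<in> E" for e using assms(1) that by (auto simp: simple_graph_def)
  from this[OF xyz(1)] this[OF xyz(2)] this[OF xyz(3)]
  have "distinct [x, y, z]" "set [x, y, z] \<subseteq> V" by auto
  moreover have "{[x, y, z] ! i, [x, y, z] ! ((i + 1) mod 3)} \<in> E" if "i < 3" for i
  proof -
    have "i = 0 \<or> i = 1 \<or> i = 2" using that by linarith
    then show ?thesis using xyz by (elim disjE) simp_all
  qed
  ultimately have "is_cycle V E [x, y, z]" by (simp add: is_cycle_def)
  then show False using assms(2,3) by (force simp: girth_at_least_def)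
qed

text \<open>Strong induction on \<open>card W\<close>. The induced subgraph is again plane of girth
  at least 8, hence too sparse for the conclusion of \<open>discharging\<close>; so it has a
  reducible vertex, and the colouring of the smaller set extends.\<close>

lemma ex_proper:
  assumes sg: "simple_graph V E" and plane: "plane_graph V E pos \<gamma>"
    and girth: "girth_at_least V E 8" and cover: "k_fold_cover 3 V E L EH"
    and "W \<subseteq> V"
  shows "\<exists>s. proper E L EH W s"
  using \<open>W \<subseteq> V\<close>
proof (induction "card W" arbitrary: W rule: less_induct)
  case less
  show ?case
  proof (cases "W = {}")
    case True
    then show ?thesis by (intro exI) (simp add: proper_def)
  next
    case False
    let ?F = "{e \<in> E. e \<subseteq> W}"
    have sgW: "simple_graph W ?F" using sg less.prems by (rule simple_graph_induced)
    have finW: "finite W" using sgW by (simp add: simple_graph_def)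
    have FE: "?F \<subseteq> E" by (rule Collect_restrict)
    have planeW: "plane_graph W ?F pos \<gamma>" using plane_graph_subgraph[OF plane sgW FE] .
    have girthW: "girth_at_least W ?F 8"
      using girth_at_least_subgraph[OF girth less.prems FE] .
    \<comment> \<open>For \<open>g = 8\<close> the edge bound reads
      \<open>3 * card ?F + 8 \<le> 4 * card W\<close>. With fewer edges than vertices the inequality
      is immediate.\<close>
    have "3 * card ?F < 4 * card W"
    proof (cases "card W \<le> card ?F")
      case True
      from plane_graph.girth_edge_bound[OF planeW girthW False this] show ?thesis by simp
    next
      case F: False
      then show ?thesis by linarith
    qed
    then obtain w where w: "w \<in> W" "card (nbrs2 ?F W w) + 3 * card (nbrs ?F W w - nbrs2 ?F W w) < 6"
      using discharging[OF sgW] by (meson not_le)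
    have nbrs_eq: "nbrs ?F W v = nbrs E W v" if "v \<in> W" for v using that by (auto simp: nbrs_def)
    have "nbrs2 ?F W w = nbrs2 E W w"
      using nbrs_eq nbrs_eq[OF w(1)] by (auto simp: nbrs2_def nbrs_def)
    with w nbrs_eq have red: "card (nbrs2 E W w) + 3 * card (nbrs E W w - nbrs2 E W w) \<le> 5" by simp
    have "card (W - insert w (nbrs2 E W w)) < card W"
      using finW w(1) by (intro psubset_card_mono) auto
    then obtain s where "proper E L EH (W - insert w (nbrs2 E W w)) s"
      using less.hyps less.prems by blast
    moreover have "False" if "{x, y} \<in> E" "{y, z} \<in> E" "{z, x} \<in> E" for x y z
      using girth_ge_4_triangle_free[OF sg girth _ that] by simp
    ultimately show ?thesis
      using extend_over_reducible_vertex[OF sg cover _ less.prems w(1) red] by metis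
  qed
qed

text \<open>A colour determines its vertex because the lists are disjoint. A common colour of the
  two sets would thus be both entries of the pair at one vertex, but these differ.\<close>

lemma proper_independent_transversals:
  assumes cov: "correspondence_cover V E L EH" and s: "proper E L EH V s"
  shows "independent_transversal V L EH (fst ` s ` V)" "independent_transversal V L EH (snd ` s ` V)"
    "fst ` s ` V \<inter> snd ` s ` V = {}"
proof -
  have st: "fst (s v) \<in> L v" "snd (s v) \<in> L v" "fst (s v) \<noteq> snd (s v)" if "v \<in> V" for v
    using s that by (force simp: proper_def states_def)+
  have "\<forall>u\<in>V. \<forall>v\<in>V. u \<noteq> v \<longrightarrow> L u \<inter> L v = {}"
    using cov by (simp add: correspondence_cover_def)
  then have disj: "u = v" if "u \<in> V" "v \<in> V" "x \<in> L u" "x \<in> L v" for u v x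
    using that by blast
  have "\<forall>f\<in>EH. card f = 2" using cov by (simp add: correspondence_cover_def)
  then have loop: "{x, x} \<notin> EH" for x by fastforce
  have nonedge: "{x, y} \<notin> EH" if "u \<in> V" "v \<in> V" "u \<noteq> v" "{u, v} \<notin> E" "x \<in> L u" "y \<in> L v" for u v x y
    using cov that by (simp add: correspondence_cover_def)
  have comp: "compatible EH (s u) (s v)" if "u \<in> V" "v \<in> V" "{u, v} \<in> E" for u v
    using s that by (simp add: proper_def)
  \<comment> \<open>\<open>f\<close> will be \<open>fst\<close> and \<open>snd\<close>. Independence
    has three cases: equal vertices (no loops in \<open>EH\<close>), adjacent ones (compatibility)
    and non-adjacent ones (no edges between the lists).\<close>
  have trans: "independent_transversal V L EH (f ` s ` V)"
    if f: "\<And>v. v \<in> V \<Longrightarrow> f (s v) \<in> L v" "\<And>a b. compatible EH a b \<Longrightarrow> {f a, f b} \<notin> EH" for f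
    unfolding independent_transversal_def
  proof (intro conjI ballI)
    show "f ` s ` V \<subseteq> (\<Union>v\<in>V. L v)" using f(1) by blast
    fix x y assume "x \<in> f ` s ` V" "y \<in> f ` s ` V"
    then obtain u v where "u \<in> V" "v \<in> V" "x = f (s u)" "y = f (s v)" by blast
    then show "{x, y} \<notin> EH"
      using loop nonedge[of u v x y] f(1) f(2)[OF comp] by (cases "u = v"; cases "{u, v} \<in> E") auto
  next
    fix v assume v: "v \<in> V"
    have "f (s u) = f (s v)" if "u \<in> V" "f (s u) \<in> L v" for u
      using disj[OF that(1) v f(1)[OF that(1)] that(2)] by simp
    then have "f ` s ` V \<inter> L v = {f (s v)}" using f(1)[OF v] v by blast
    then show "card (f ` s ` V \<inter> L v) = 1" by simp
  qed
  show "independent_transversal V L EH (fst ` s ` V)" "independent_transversal V L EH (snd ` s ` V)"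
    by (rule trans; use st in \<open>auto simp: compatible_def\<close>)+
  show "fst ` s ` V \<inter> snd ` s ` V = {}"
  proof (rule ccontr)
    assume "fst ` s ` V \<inter> snd ` s ` V \<noteq> {}"
    then obtain u v where "u \<in> V" "v \<in> V" "fst (s u) = snd (s v)" by auto
    with st disj show False by metis
  qed
qed

theorem mainTheorem5:
  fixes V :: "'v set" and E :: "'v set set" and L :: "'v \<Rightarrow> 'c set" and EH :: "'c set set"
  assumes "simple_graph V E"
    and "planar V E"
    and "girth_at_least V E 8"
    and "k_fold_cover 3 V E L EH"
  shows "\<exists>I1 I2. independent_transversal V L EH I1 \<and> independent_transversal V L EH I2 \<and>
                I1 \<inter> I2 = {}"
proof -
  obtain pos \<gamma> where "plane_graph V E pos \<gamma>"
    using planar_imp_plane_graph[OF assms(1,2)] .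
  then obtain s where "proper E L EH V s"
    using ex_proper[OF assms(1) _ assms(3,4) subset_refl] by blast
  moreover have "correspondence_cover V E L EH" using assms(4) by (simp add: k_fold_cover_def)
  ultimately show ?thesis using proper_independent_transversals by blast
qed

end
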